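(* Let $(p_h^1,p_h^2,\phi_h)\in[S_h(\Omega)]^3$ be the finite element solution on the fine grid, let $(p_H^1,p_H^2,\phi_H)\in[S_H(\Omega)]^3$ be the finite element solution on the coarse grid, and let $(p_h^{1,*},p_h^{2,*},\phi_h^* )\in[S_h(\Omega)]^3$ be the fully decoupled two-grid solution on the fine grid, all as defined in the context. Then there is a constant $C>0$, independent of the mesh sizes $h$ and $H$, such that $$\|\nabla(\phi_h-\phi_h^* )\|_{0,\Omega}\le C\sum_{i=1}^2\|p_h^i-p_H^i\|_{0,\Omega}.$$
   Context: Let $\Omega\subset\mathbb{R}^d$ ($d=2,3$) be a bounded Lipschitz domain, $(\cdot,\cdot)$ the $L^2(\Omega)$ inner product, and $\|\cdot\|_{0,\Omega}$ the $L^2(\Omega)$ norm. Let $q^1=1$, $q^2=-1$, and let $F_1,F_2,F_3\in L^2(\Omega)$ be given. Let $\Gamma_h$ be a quasi-uniform triangulation of $\Omega$ with mesh size $h>0$, and let $S_h(\Omega)=\{v\in H^1(\Omega): v|_{\partial\Omega}=0,\ v|_e \text{ is a polynomial of degree at most } 1 \text{ for every } e\in\Gamma_h\}$. The coarse space $S_H(\Omega)$ is defined in the same way with $h$ replaced by $H$. Standing assumption: the weak steady-state Poisson-Nernst-Planck problem, find $p^1,p^2,\phi\in H_0^1(\Omega)$ with $(\nabla p^i,\nabla v)+(q^ip^i\nabla\phi,\nabla v)=(F_i,v)$ for all $v\in H_0^1(\Omega)$, $i=1,2$, and $(\nabla\phi,\nabla w)=\sum_{i=1}^2 q^i(p^i,w)+(F_3,w)$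 for all $w\in H_0^1(\Omega)$, has a unique solution, and the finite element problems below have unique solutions. Finite element solution on the fine grid: $(p_h^1,p_h^2,\phi_h)\in[S_h(\Omega)]^3$ satisfies $$(\nabla p_h^i,\nabla v_h)+(q^ip_h^i\nabla\phi_h,\nabla v_h)=(F_i,v_h)\quad\forall v_h\in S_h(\Omega),\ i=1,2,$$ $$(\nabla\phi_h,\nabla w_h)=\sum_{i=1}^2q^i(p_h^i,w_h)+(F_3,w_h)\quad\forall w_h\in S_h(\Omega).$$ Finite element solution on the coarse grid: $(p_H^1,p_H^2,\phi_H)\in[S_H(\Omega)]^3$ satisfies the same system with $h$ replaced by $H$ throughout. Fully decoupled two-grid solution: $(p_h^{1,*},p_h^{2,*},\phi_h^* )\in[S_h(\Omega)]^3$ is determined by $$(\nabla p_h^{i,*},\nabla v_h)=(F_i,v_h)-(q^ip_H^i\nabla\phi_H,\nabla v_h)\quad\forall v_h\in S_h(\Omega),\ i=1,2,$$ $$(\nabla\phi_h^*,\nabla w_h)=\sum_{i=1}^2q^i(p_H^i,w_h)+(F_3,w_h)\quad\forall w_h\in S_h(\Omega).$$ *)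

theory Defs
  imports "HOL-Analysis.Analysis"
begin

section \<open>Lipschitz domains\<close>

text \<open>Near each boundary point, in orthonormal coordinates whose last axis is \<open>\<nu>\<close>, the set lies
  strictly above the graph of a Lipschitz function of the remaining coordinates
  \<open>y - (y \<bullet> \<nu>) \<nu>\<close>.\<close>

definition lipschitz_domain :: "(real^'d) set \<Rightarrow> bool" where
  "lipschitz_domain \<Omega> \<longleftrightarrow> open \<Omega> \<and> connected \<Omega> \<and> \<Omega> \<noteq> {} \<and>
     (\<forall>x\<in>frontier \<Omega>. \<exists>r>0. \<exists>\<nu> \<gamma> L. norm \<nu> = 1 \<and> L-lipschitz_on {z. z \<bullet> \<nu> = 0} \<gamma> \<and>
        \<Omega> \<inter> ball x r = {y \<in> ball x r. \<gamma> (y - (y \<bullet> \<nu>) *\<^sub>R \<nu>) < y \<bullet> \<nu>})"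


section \<open>Lebesgue and Sobolev spaces\<close>

text \<open>Members of \<open>L2\<close>, \<open>H1\<close> and \<open>H10\<close> are functions on the whole space, of which
  only the restriction to \<open>\<Omega>\<close>, up to almost everywhere equality, matters.\<close>

definition L2 :: "(real^'d) set \<Rightarrow> (real^'d \<Rightarrow> 'b::euclidean_space) set" where
  "L2 \<Omega> = {f \<in> borel_measurable (lebesgue_on \<Omega>). integrable (lebesgue_on \<Omega>) (\<lambda>x. (norm (f x))\<^sup>2)}"

definition L2_inner ::
    "(real^'d) set \<Rightarrow> (real^'d \<Rightarrow> 'b::euclidean_space) \<Rightarrow> (real^'d \<Rightarrow> 'b) \<Rightarrow> real" where
  "L2_inner \<Omega> f g = (LINT x|lebesgue_on \<Omega>. f x \<bullet> g x)"

definition L2_norm :: "(real^'d) set \<Rightarrow> (real^'d \<Rightarrow> 'b::euclidean_space) \<Rightarrow> real" where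
  "L2_norm \<Omega> f = sqrt (L2_inner \<Omega> f f)"

definition partial_deriv :: "'d \<Rightarrow> (real^'d \<Rightarrow> real) \<Rightarrow> real^'d \<Rightarrow> real" where
  "partial_deriv i f x = frechet_derivative f (at x) (axis i 1)"

primrec C_differentiable :: "nat \<Rightarrow> (real^'d \<Rightarrow> real) \<Rightarrow> bool" where
  "C_differentiable 0 f \<longleftrightarrow> continuous_on UNIV f"
| "C_differentiable (Suc k) f \<longleftrightarrow>
     (\<forall>x. f differentiable at x) \<and> (\<forall>i. C_differentiable k (partial_deriv i f))"

definition test_functions :: "(real^'d) set \<Rightarrow> (real^'d \<Rightarrow> real) set" where
  "test_functions \<Omega> = {\<psi>. (\<forall>k. C_differentiable k \<psi>) \<and>
     compact (closure {x. \<psi> x \<noteq> 0}) \<and> closure {x. \<psi> x \<noteq> 0} \<subseteq> \<Omega>}"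

definition weak_gradient ::
    "(real^'d) set \<Rightarrow> (real^'d \<Rightarrow> real) \<Rightarrow> (real^'d \<Rightarrow> real^'d) \<Rightarrow> bool" where
  "weak_gradient \<Omega> u g \<longleftrightarrow> (\<forall>\<psi>\<in>test_functions \<Omega>. \<forall>i.
     (LINT x|lebesgue_on \<Omega>. u x * partial_deriv i \<psi> x) = - (LINT x|lebesgue_on \<Omega>. g x $ i * \<psi> x))"

definition H1 :: "(real^'d) set \<Rightarrow> (real^'d \<Rightarrow> real) set" where
  "H1 \<Omega> = {u \<in> L2 \<Omega>. \<exists>g\<in>L2 \<Omega>. weak_gradient \<Omega> u g}"

text \<open>The weak gradient is determined only almost everywhere on \<open>\<Omega>\<close>; \<open>grad\<close> picks a
  representative, and is meaningful only on \<open>H1 \<Omega>\<close>.\<close>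

definition grad :: "(real^'d) set \<Rightarrow> (real^'d \<Rightarrow> real) \<Rightarrow> real^'d \<Rightarrow> real^'d" where
  "grad \<Omega> u = (SOME g. g \<in> L2 \<Omega> \<and> weak_gradient \<Omega> u g)"

definition H1_norm :: "(real^'d) set \<Rightarrow> (real^'d \<Rightarrow> real) \<Rightarrow> real" where
  "H1_norm \<Omega> u = sqrt ((L2_norm \<Omega> u)\<^sup>2 + (L2_norm \<Omega> (grad \<Omega> u))\<^sup>2)"

text \<open>Closure of the test functions in \<open>H1\<close>.\<close>

definition H10 :: "(real^'d) set \<Rightarrow> (real^'d \<Rightarrow> real) set" where
  "H10 \<Omega> = {u \<in> H1 \<Omega>. \<exists>\<psi>. (\<forall>n. \<psi> n \<in> test_functions \<Omega>) \<and>
     (\<lambda>n::nat. H1_norm \<Omega> (\<lambda>x. \<psi> n x - u x)) \<longlonglongrightarrow> 0}"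


section \<open>Triangulations and finite element spaces\<close>

text \<open>A conforming triangulation into closed nondegenerate simplices. The mesh size is the largest
  element diameter, and quasi-uniformity with constant \<open>\<sigma>\<close> means that every element contains a ball
  of radius \<open>\<sigma> h\<close>.\<close>

definition quasi_uniform_triangulation ::
    "(real^'d) set \<Rightarrow> real \<Rightarrow> real \<Rightarrow> (real^'d) set set \<Rightarrow> bool" where
  "quasi_uniform_triangulation \<Omega> \<sigma> h \<T> \<longleftrightarrow>
     triangulation \<T> \<and> (\<forall>e\<in>\<T>. int CARD('d) simplex e) \<and> \<Union>\<T> = closure \<Omega> \<and>
     0 < h \<and> h = Max (diameter ` \<T>) \<and>
     (\<forall>e\<in>\<T>. \<exists>c. cball c (\<sigma> * h) \<subseteq> e)"

text \<open>The elements are closed and cover \<open>closure \<Omega>\<close>, so being affine on each of them makes \<open>v\<close>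
  continuous on \<open>closure \<Omega>\<close>; members are thus the continuous representatives of their
  almost-everywhere classes, and the boundary condition is meant pointwise.\<close>

definition fe_space :: "(real^'d) set \<Rightarrow> (real^'d) set set \<Rightarrow> (real^'d \<Rightarrow> real) set" where
  "fe_space \<Omega> \<T> = {v \<in> H1 \<Omega>. (\<forall>x\<in>frontier \<Omega>. v x = 0) \<and>
     (\<forall>e\<in>\<T>. \<exists>a b. \<forall>x\<in>e. v x = a \<bullet> x + b)}"


section \<open>The Poisson--Nernst--Planck problems\<close>

definition valence :: "nat \<Rightarrow> real" where
  "valence i = (if i = 1 then 1 else - 1)"

text \<open>The system with trial and test space \<open>V\<close>: the weak problem for \<open>V = H10 \<Omega>\<close>, and the finite
  element problem when \<open>V\<close> is a finite element space. Concentrations are indexed by 1 and 2, sources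
  by 1, 2 and 3. The integrability condition says that the drift term is well defined; otherwise
  the Bochner integral would be 0 by convention. It is automatic on finite element spaces.\<close>

definition PNP_solution ::
    "(real^'d) set \<Rightarrow> (nat \<Rightarrow> real^'d \<Rightarrow> real) \<Rightarrow> (real^'d \<Rightarrow> real) set \<Rightarrow>
     (nat \<Rightarrow> real^'d \<Rightarrow> real) \<Rightarrow> (real^'d \<Rightarrow> real) \<Rightarrow> bool" where
  "PNP_solution \<Omega> F V p \<phi> \<longleftrightarrow>
     (\<forall>i\<in>{1,2}. p i \<in> V) \<and> \<phi> \<in> V \<and>
     (\<forall>i\<in>{1,2}. \<forall>v\<in>V.
        integrable (lebesgue_on \<Omega>) (\<lambda>x. (valence i * p i x) *\<^sub>R grad \<Omega> \<phi> x \<bullet> grad \<Omega> v x) \<and>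
        L2_inner \<Omega> (grad \<Omega> (p i)) (grad \<Omega> v)
          + L2_inner \<Omega> (\<lambda>x. (valence i * p i x) *\<^sub>R grad \<Omega> \<phi> x) (grad \<Omega> v)
          = L2_inner \<Omega> (F i) v) \<and>
     (\<forall>w\<in>V. L2_inner \<Omega> (grad \<Omega> \<phi>) (grad \<Omega> w)
        = (\<Sum>i\<in>{1,2}. valence i * L2_inner \<Omega> (p i) w) + L2_inner \<Omega> (F 3) w)"

definition uniquely_solvable ::
    "(real^'d) set \<Rightarrow> (nat \<Rightarrow> real^'d \<Rightarrow> real) \<Rightarrow> (real^'d \<Rightarrow> real) set \<Rightarrow> bool" where
  "uniquely_solvable \<Omega> F V \<longleftrightarrow>
     (\<exists>p \<phi>. PNP_solution \<Omega> F V p \<phi>) \<and>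
     (\<forall>p \<phi> p' \<phi>'. PNP_solution \<Omega> F V p \<phi> \<and> PNP_solution \<Omega> F V p' \<phi>' \<longrightarrow>
        (\<forall>i\<in>{1,2}. AE x in lebesgue_on \<Omega>. p i x = p' i x) \<and>
        (AE x in lebesgue_on \<Omega>. \<phi> x = \<phi>' x))"

text \<open>Here \<open>V\<close> is the fine space and \<open>(pH, \<phi>H)\<close> the coarse solution.\<close>

definition two_grid_solution ::
    "(real^'d) set \<Rightarrow> (nat \<Rightarrow> real^'d \<Rightarrow> real) \<Rightarrow> (real^'d \<Rightarrow> real) set \<Rightarrow>
     (nat \<Rightarrow> real^'d \<Rightarrow> real) \<Rightarrow> (real^'d \<Rightarrow> real) \<Rightarrow>
     (nat \<Rightarrow> real^'d \<Rightarrow> real) \<Rightarrow> (real^'d \<Rightarrow> real) \<Rightarrow> bool" where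
  "two_grid_solution \<Omega> F V pH \<phi>H ps \<phi>s \<longleftrightarrow>
     (\<forall>i\<in>{1,2}. ps i \<in> V) \<and> \<phi>s \<in> V \<and>
     (\<forall>i\<in>{1,2}. \<forall>v\<in>V. L2_inner \<Omega> (grad \<Omega> (ps i)) (grad \<Omega> v)
        = L2_inner \<Omega> (F i) v
          - L2_inner \<Omega> (\<lambda>x. (valence i * pH i x) *\<^sub>R grad \<Omega> \<phi>H x) (grad \<Omega> v)) \<and>
     (\<forall>w\<in>V. L2_inner \<Omega> (grad \<Omega> \<phi>s) (grad \<Omega> w)
        = (\<Sum>i\<in>{1,2}. valence i * L2_inner \<Omega> (pH i) w) + L2_inner \<Omega> (F 3) w)"

end

theory Submission
  imports Defs "HOL-Computational_Algebra.Polynomial"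
begin

text \<open>Testing the two Poisson equations with \<open>w = \<phi>h - \<phi>s\<close> and subtracting gives
  \<open>\<parallel>\<nabla>w\<parallel>\<^sup>2 = \<Sum>i. q i (ph i - pH i, w)\<close>, so the claim follows from Cauchy-Schwarz and the Poincare
  inequality \<open>\<parallel>w\<parallel> \<le> 2 R \<parallel>\<nabla>w\<parallel>\<close> for \<open>\<Omega>\<close> inside a ball of radius \<open>R\<close>. Linearity of \<open>grad\<close> rests on the
  almost everywhere uniqueness of weak gradients, for which smooth functions approximating the
  indicators of boxes are needed. The extension of \<open>w\<close> by zero is Lipschitz and differentiable
  almost everywhere, being affine on each of finitely many closed pieces. For such functions
  integration by parts follows from translation invariance of the Lebesgue measure; it identifies the
  pointwise gradient of \<open>w\<close> with the weak one and yields the Poincare inequality.\<close>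

section \<open>Smooth approximation of boxes\<close>

text \<open>The finite element spaces are cut out by a pointwise boundary condition and not as
  subspaces of \<open>H10\<close>, so carrying the Poincare inequality over from test functions by
  density would first require placing them there. Extension by zero takes the place of that
  argument: the complement of the domain is one more closed piece on which the function is affine,
  and the boundary condition turns into Lipschitz continuity on the whole space, where no boundary
  terms arise. The Lipschitz constants depend on the mesh and may blow up under refinement, but they
  serve only qualitatively, to justify limits and integrability. The final inequality retains
  nothing but the factor 2 of the product rule and the radius \<open>R\<close>, which is why its
  constant is uniform in \<open>h\<close> and \<open>H\<close>. Since \<open>grad\<close> is an
  arbitrary choice among the weak gradients, every identity about it is available only up to null
  sets and is used only under integrals.\<close>

lemma partial_deriv_eq:
  assumes "(f has_derivative f') (at x)"
  shows "partial_deriv i f x = f' (axis i 1)"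
  using frechet_derivative_at[OF assms] by (simp add: partial_deriv_def)

lemma partial_deriv_has_real_derivative:
  assumes "f differentiable at x"
  shows "((\<lambda>t. f (x + t *\<^sub>R axis i 1)) has_real_derivative partial_deriv i f x) (at 0)"
proof -
  have 1: "(f has_derivative frechet_derivative f (at x)) (at x)"
    using assms frechet_derivative_works by blast
  have "((\<lambda>t. f (x + t *\<^sub>R axis i 1)) has_derivative
      (\<lambda>t. frechet_derivative f (at x) (t *\<^sub>R axis i 1))) (at 0)"
    by (rule has_derivative_compose[where g = f and f = "\<lambda>t. x + t *\<^sub>R axis i 1"])
      (auto intro!: derivative_eq_intros 1)
  moreover have "frechet_derivative f (at x) (t *\<^sub>R axis i 1) = partial_deriv i f x * t" for t
    using linear_scale[OF has_derivative_linear[OF 1]] by (simp add: partial_deriv_def)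
  ultimately show ?thesis
    by (simp add: has_field_derivative_def)
qed

lemma partial_deriv_mult:
  assumes "f differentiable at x" "g differentiable at x"
  shows "partial_deriv i (\<lambda>x. f x * g x) x = f x * partial_deriv i g x + partial_deriv i f x * g x"
proof -
  have "((\<lambda>x. f x * g x) has_derivative
      (\<lambda>h. f x * frechet_derivative g (at x) h + frechet_derivative f (at x) h * g x)) (at x)"
    using assms by (intro has_derivative_mult) (auto simp: frechet_derivative_works[symmetric])
  from partial_deriv_eq[OF this] show ?thesis
    by (simp add: partial_deriv_def)
qed

lemma C_differentiable_continuous_on: "C_differentiable k f \<Longrightarrow> continuous_on UNIV f"
  by (cases k) (auto simp: differentiable_imp_continuous_within continuous_at_imp_continuous_on)

lemma C_differentiable_Suc_imp: "C_differentiable (Suc k) f \<Longrightarrow> C_differentiable k f"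
proof (induction k arbitrary: f)
  case 0
  then show ?case
    using C_differentiable_continuous_on[OF 0] by simp
next
  case (Suc k)
  then show ?case
    using C_differentiable.simps(2) by metis
qed

lemma C_differentiable_add:
  "C_differentiable k f \<Longrightarrow> C_differentiable k g \<Longrightarrow> C_differentiable k (\<lambda>x. f x + g x)"
proof (induction k arbitrary: f g)
  case 0
  then show ?case by (auto intro: continuous_on_add)
next
  case (Suc k)
  have "partial_deriv i (\<lambda>x. f x + g x) = (\<lambda>x. partial_deriv i f x + partial_deriv i g x)" for i
  proof
    fix x
    have "((\<lambda>x. f x + g x) has_derivative
        (\<lambda>h. frechet_derivative f (at x) h + frechet_derivative g (at x) h)) (at x)"
      using Suc.prems by (intro has_derivative_add) (auto simp: frechet_derivative_works[symmetric])
    from partial_deriv_eq[OF this] show "partial_deriv i (\<lambda>x. f x + g x) x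
        = partial_deriv i f x + partial_deriv i g x"
      by (simp add: partial_deriv_def)
  qed
  with Suc show ?case by (auto intro: derivative_intros)
qed

lemma C_differentiable_mult:
  "C_differentiable k f \<Longrightarrow> C_differentiable k g \<Longrightarrow> C_differentiable k (\<lambda>x. f x * g x)"
proof (induction k arbitrary: f g)
  case 0
  then show ?case by (auto intro: continuous_on_mult)
next
  case (Suc k)
  have "partial_deriv i (\<lambda>x. f x * g x) = (\<lambda>x. f x * partial_deriv i g x + partial_deriv i f x * g x)" for i
    using Suc.prems by (auto simp: partial_deriv_mult)
  \<comment> \<open>Each term of the product rule keeps one undifferentiated factor, whose order has
    to be lowered to \<open>k\<close> before the induction hypothesis applies.\<close>
  moreover have "C_differentiable k f" "C_differentiable k g"
    using Suc.prems C_differentiable_Suc_imp by auto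
  ultimately show ?case
    using Suc by (auto intro!: differentiable_mult C_differentiable_add)
qed

lemma C_differentiable_const: "C_differentiable k (\<lambda>x::real^'d. c)"
proof (induction k arbitrary: c)
  case (Suc k)
  have "partial_deriv i (\<lambda>x::real^'d. c) = (\<lambda>x. 0)" for i
    using partial_deriv_eq[OF has_derivative_const] by fastforce
  with Suc[of 0] show ?case by simp
qed simp

lemma C_differentiable_prod:
  assumes "\<And>i. i \<in> I \<Longrightarrow> C_differentiable k (f i)"
  shows "C_differentiable k (\<lambda>x. \<Prod>i\<in>I. f i x)"
  using assms
  by (induction I rule: infinite_finite_induct)
    (auto intro: C_differentiable_const C_differentiable_mult)

text \<open>The induction runs over all \<open>n\<close> and \<open>c\<close>: a partial derivative
  moves from \<open>D n\<close> to \<open>D (Suc n)\<close> and turns the coefficient into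
  \<open>c * \<alpha>\<close>, or into 0 for the other coordinates, so the shape is
  preserved.\<close>

lemma C_differentiable_coordinate:
  assumes D: "\<And>n t. (D n has_real_derivative D (Suc n) t) (at t)"
  shows "C_differentiable k (\<lambda>x. c * D n (\<alpha> * x $ i + \<beta>))"
proof (induction k arbitrary: c n)
  have der: "((\<lambda>x. c * D n (\<alpha> * x $ i + \<beta>)) has_derivative
      (\<lambda>h. c * (D (Suc n) (\<alpha> * x $ i + \<beta>) * (\<alpha> * h $ i)))) (at x)" for c n and x :: "real^'a"
    by (rule has_derivative_mult_right,
        rule has_derivative_compose[where g = "D n" and f = "\<lambda>x. \<alpha> * x $ i + \<beta>"])
      (auto intro!: derivative_eq_intros bounded_linear.has_derivative[OF bounded_linear_vec_nth]
         D[unfolded has_field_derivative_def])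
  case 0
  show ?case
    using der by (auto intro!: continuous_at_imp_continuous_on has_derivative_continuous)
  case (Suc k)
  have "partial_deriv j (\<lambda>x. c * D n (\<alpha> * x $ i + \<beta>)) =
      (\<lambda>x. (if j = i then c * \<alpha> else 0) * D (Suc n) (\<alpha> * x $ i + \<beta>))" for j
    by (rule ext, subst partial_deriv_eq[OF der]) (auto simp: axis_def)
  moreover have "(\<lambda>x. c * D n (\<alpha> * x $ i + \<beta>)) differentiable at x" for x :: "real^'a"
    unfolding differentiable_def using der by blast
  ultimately show ?case using Suc by simp
qed

text \<open>The derivative of \<open>p (1 / t) exp (- c / t)\<close> is again of this form, with \<open>u\<^sup>2 (c p - p')\<close> in place
  of the polynomial \<open>p\<close> in \<open>u = 1 / t\<close>; hence smoothness at 0 needs one limit only.\<close>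

definition flat :: "real \<Rightarrow> real poly \<Rightarrow> real \<Rightarrow> real" where
  "flat c p t = (if t > 0 then poly p (1 / t) * exp (- (c / t)) else 0)"

text \<open>With \<open>u = 1 / t\<close> this is the decay of \<open>flat c p\<close> as
  \<open>t\<close> decreases to 0. Monomial by monomial it is the dominance of the exponential over
  powers, applied to \<open>c * u\<close>.\<close>

lemma tendsto_poly_times_exp_minus:
  fixes c :: real
  assumes "c > 0"
  shows "((\<lambda>u. poly p u * exp (- (c * u))) \<longlongrightarrow> 0) at_top"
proof -
  have "((\<lambda>u. u ^ i * exp (- (c * u))) \<longlongrightarrow> 0) at_top" for i
  proof -
    have "filterlim (\<lambda>u. c * u) at_top at_top"
      using assms by (intro filterlim_tendsto_pos_mult_at_top[OF tendsto_const]) (auto intro: filterlim_ident)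
    from filterlim_compose[OF tendsto_power_div_exp_0 this]
    have "((\<lambda>u. (1 / c ^ i) * ((c * u) ^ i / exp (c * u))) \<longlongrightarrow> (1 / c ^ i) * 0) at_top"
      by (intro tendsto_mult tendsto_const)
    moreover have "(\<lambda>u. (1 / c ^ i) * ((c * u) ^ i / exp (c * u))) = (\<lambda>u. u ^ i * exp (- (c * u)))"
      using assms by (auto simp: power_mult_distrib exp_minus field_simps)
    ultimately show ?thesis by simp
  qed
  then have "((\<lambda>u. \<Sum>i\<le>degree p. coeff p i * (u ^ i * exp (- (c * u)))) \<longlongrightarrow> (\<Sum>i\<le>degree p. coeff p i * 0)) at_top"
    by (intro tendsto_sum tendsto_mult tendsto_const)
  then show ?thesis
    by (simp add: poly_altdef sum_distrib_right mult.assoc)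
qed

lemma flat_has_derivative:
  assumes "c > 0"
  shows "(flat c p has_real_derivative flat c (monom 1 2 * (smult c p - pderiv p)) t) (at t)"
proof (rule linorder_cases[of t 0])
  assume "t < 0"
  then have "\<forall>\<^sub>F s in nhds t. flat c p s = 0"
    using eventually_nhds_in_open[of "{..<0}" t]
    by (auto simp: flat_def elim: eventually_mono)
  then show ?thesis
    using \<open>t < 0\<close> by (subst DERIV_cong_ev[OF refl _ refl]) (auto simp: flat_def)
next
  assume "t > 0"
  then have *: "\<forall>\<^sub>F s in nhds t. flat c p s = poly p (1 / s) * exp (- (c / s))"
    using eventually_nhds_in_open[of "{0<..}" t]
    by (auto simp: flat_def elim: eventually_mono)
  have "((\<lambda>s. poly p (1 / s) * exp (- (c / s))) has_real_derivative
      poly (monom 1 2 * (smult c p - pderiv p)) (1 / t) * exp (- (c / t))) (at t)"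
    using \<open>t > 0\<close>
    by (auto intro!: derivative_eq_intros poly_DERIV[THEN DERIV_chain2]
        simp: poly_monom field_simps power2_eq_square)
  then show ?thesis
    using \<open>t > 0\<close> by (subst DERIV_cong_ev[OF refl * refl]) (auto simp: flat_def)
next
  assume t: "t = 0"
  \<comment> \<open>Dividing \<open>flat c p s\<close> by \<open>s\<close> multiplies the polynomial
    in \<open>1 / s\<close> by its variable, which gives \<open>pCons 0 p\<close>; so the difference
    quotient at 0 is again covered by the limit lemma.\<close>
  have "((\<lambda>u. poly (pCons 0 p) u * exp (- (c * u))) \<longlongrightarrow> 0) at_top"
    by (rule tendsto_poly_times_exp_minus[OF assms])
  from filterlim_compose[OF this filterlim_inverse_at_top_right]
  have "((\<lambda>s. flat c p s / s) \<longlongrightarrow> 0) (at_right 0)"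
    by (rule Lim_transform_eventually)
      (auto simp: flat_def eventually_at_right_field field_simps intro: exI[of _ 1])
  moreover have "((\<lambda>s. flat c p s / s) \<longlongrightarrow> 0) (at_left 0)"
    by (rule Lim_transform_eventually[OF tendsto_const])
      (auto simp: flat_def eventually_at_left_field intro: exI[of _ "-1"])
  ultimately have "((\<lambda>s. flat c p s / s) \<longlongrightarrow> 0) (at 0)"
    by (rule filterlim_split_at[rotated])
  then show ?thesis
    by (simp add: t DERIV_def flat_def)
qed

text \<open>The approximants are products of one-sided flat functions, two for each coordinate. They
  vanish on the faces for every \<open>n\<close>, so their limit is the indicator of the open box,
  while their supports fill the closed box; hence the hypothesis on \<open>cbox a b\<close>.\<close>

lemma exists_test_functions_to_box:
  fixes \<Omega> :: "(real^'d) set"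
  assumes "cbox a b \<subseteq> \<Omega>"
  obtains \<psi> where "\<And>n::nat. \<psi> n \<in> test_functions \<Omega>"
    and "\<And>n x. \<bar>\<psi> n x\<bar> \<le> 1"
    and "\<And>x. (\<lambda>n. \<psi> n x) \<longlonglongrightarrow> indicator (box a b) x"
proof
  \<comment> \<open>This is the flat function \<open>exp (- 1 / t)\<close> with its exponent scaled
    by \<open>1 / Suc n\<close>. It stays below 1 and tends to 1 at every positive \<open>t\<close>,
    so the scaling does the work of a mollifier.\<close>
  define s where "s = (\<lambda>n::nat. flat (1 / Suc n) 1)"
  have s_bounds: "0 \<le> s n t" "s n t \<le> 1" for n t
    by (auto simp: s_def flat_def)
  have s_lim: "(\<lambda>n. s n t) \<longlonglongrightarrow> indicator {0<..} t" for t
  proof (cases "t > 0")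
    case True
    have "(\<lambda>n. exp (- (1 / t) * (1 / real (Suc n)))) \<longlonglongrightarrow> exp (- (1 / t) * 0)"
      by (intro tendsto_intros LIMSEQ_inverse_real_of_nat[unfolded inverse_eq_divide])
    with True show ?thesis by (simp add: s_def flat_def field_simps)
  qed (simp add: s_def flat_def)
  define \<psi> where "\<psi> = (\<lambda>n x. \<Prod>i\<in>UNIV. s n (x $ i - a $ i) * s n (b $ i - x $ i))"
  have "C_differentiable k (\<lambda>x::real^'d. s n (\<alpha> * x $ i + \<beta>))" for k n i \<alpha> \<beta>
  proof -
    define c where "c = 1 / real (Suc n)"
    \<comment> \<open>Iterating the polynomial map of \<open>flat_has_derivative\<close> from 1
      lists all derivatives of \<open>s n\<close> in one sequence, as
      \<open>C_differentiable_coordinate\<close> requires.\<close>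
    define D where "D = (\<lambda>k. flat c (((\<lambda>p. monom 1 2 * (smult c p - pderiv p)) ^^ k) 1))"
    have "(D k has_real_derivative D (Suc k) t) (at t)" for k t
      using flat_has_derivative[of c] by (simp add: D_def c_def)
    from C_differentiable_coordinate[where D = D and c = 1 and n = 0, OF this] show ?thesis
      by (simp add: s_def D_def c_def)
  qed
  from this[of _ _ 1 _ "- a $ i" for i] this[of _ _ "-1" _ "b $ i" for i]
  have "C_differentiable k (\<psi> n)" for k n
    unfolding \<psi>_def by (intro C_differentiable_prod C_differentiable_mult) auto
  moreover have "closure {x. \<psi> n x \<noteq> 0} \<subseteq> cbox a b" for n
  proof (rule closure_minimal[OF _ closed_cbox])
    show "{x. \<psi> n x \<noteq> 0} \<subseteq> cbox a b"
    proof
      fix x assume "x \<in> {x. \<psi> n x \<noteq> 0}"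
      then have "s n (x $ i - a $ i) \<noteq> 0 \<and> s n (b $ i - x $ i) \<noteq> 0" for i
        by (simp add: \<psi>_def)
      then have "a $ i < x $ i \<and> x $ i < b $ i" for i
        by (metis diff_gt_0_iff_gt flat_def s_def)
      then show "x \<in> cbox a b" by (simp add: mem_box_cart less_imp_le)
    qed
  qed
  moreover have "compact (closure {x. \<psi> n x \<noteq> 0})" for n
    using calculation(2)[of n] closed_closure compact_cbox compact_Int_closed
    by (metis inf.absorb2)
  ultimately show "\<psi> n \<in> test_functions \<Omega>" for n
    using assms unfolding test_functions_def by blast
  show "\<bar>\<psi> n x\<bar> \<le> 1" for n x
    unfolding \<psi>_def abs_prod
    by (rule prod_le_1) (auto simp: abs_mult s_bounds intro: mult_le_one)
  show "(\<lambda>n. \<psi> n x) \<longlonglongrightarrow> indicator (box a b) x" for x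
  proof -
    have "(\<lambda>n. \<psi> n x) \<longlonglongrightarrow> (\<Prod>i\<in>UNIV. indicator {0<..} (x $ i - a $ i) * indicator {0<..} (b $ i - x $ i))"
      unfolding \<psi>_def by (intro tendsto_intros s_lim)
    also have "(\<Prod>i\<in>UNIV. indicator {0<..} (x $ i - a $ i) * indicator {0<..} (b $ i - x $ i))
       = (indicator (box a b) x :: real)"
      by (auto simp: indicator_def mem_box_cart intro!: prod.neutral)
    finally show ?thesis .
  qed
qed

lemma test_function_continuous_on: "\<psi> \<in> test_functions \<Omega> \<Longrightarrow> continuous_on S \<psi>"
  using C_differentiable_continuous_on continuous_on_subset
  by (fastforce simp: test_functions_def)

section \<open>The fundamental lemma of the calculus of variations\<close>

lemma integral_indicator_box_eq_0:
  fixes u :: "real^'d \<Rightarrow> real"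
  assumes "open \<Omega>" and u: "integrable (lebesgue_on \<Omega>) u"
    and ortho: "\<And>\<psi>. \<psi> \<in> test_functions \<Omega> \<Longrightarrow> (LINT x|lebesgue_on \<Omega>. u x * \<psi> x) = 0"
    and "cbox a b \<subseteq> \<Omega>"
  shows "(LINT x|lebesgue_on \<Omega>. u x * indicator (box a b) x) = 0"
proof -
  obtain \<psi> where \<psi>: "\<And>n::nat. \<psi> n \<in> test_functions \<Omega>" "\<And>n x. \<bar>\<psi> n x\<bar> \<le> 1"
      "\<And>x. (\<lambda>n. \<psi> n x) \<longlonglongrightarrow> indicator (box a b) x"
    using exists_test_functions_to_box[OF assms(4)] by metis
  note [measurable] = borel_measurable_integrable[OF u]
  have meas[measurable]: "\<psi> n \<in> borel_measurable (lebesgue_on \<Omega>)" for n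
    using \<open>open \<Omega>\<close>
    by (intro continuous_imp_measurable_on_sets_lebesgue test_function_continuous_on[OF \<psi>(1)]) auto
  have "(\<lambda>n. LINT x|lebesgue_on \<Omega>. u x * \<psi> n x) \<longlonglongrightarrow> (LINT x|lebesgue_on \<Omega>. u x * indicator (box a b) x)"
  proof (rule integral_dominated_convergence[where w = "\<lambda>x. \<bar>u x\<bar>"])
    show "(\<lambda>x. u x * indicator (box a b) x) \<in> borel_measurable (lebesgue_on \<Omega>)"
      by (rule borel_measurable_LIMSEQ_real[where u = "\<lambda>n x. u x * \<psi> n x"])
        (auto intro!: tendsto_intros \<psi>)
    show "AE x in lebesgue_on \<Omega>. norm (u x * \<psi> n x) \<le> \<bar>u x\<bar>" for n
      using \<psi>(2) by (auto simp: abs_mult mult_left_le)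
  qed (auto intro!: tendsto_intros \<psi> integrable_abs u)
  then show ?thesis
    by (simp add: ortho[OF \<psi>(1)] LIMSEQ_const_iff)
qed

text \<open>A pi-lambda argument: open boxes are stable under intersection and generate the Borel
  sets, so the integral of \<open>v\<close> vanishes over every Borel set, then over every Lebesgue
  set, and \<open>v\<close> has the same integrals as 0.\<close>

lemma AE_zero_if_box_integrals_zero:
  fixes v :: "'a::euclidean_space \<Rightarrow> real"
  assumes v: "integrable lebesgue v"
    and box: "\<And>a b. (LINT x|lebesgue. indicator (box a b) x * v x) = 0"
  shows "AE x in lebesgue. v x = 0"
proof (rule density_unique_real[OF v integrable_zero])
  fix A :: "'a set" assume "A \<in> sets lebesgue"
  have int: "integrable lebesgue (\<lambda>x. indicator A x * v x)" if "A \<in> sets lebesgue" for A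
    using integrable_mult_indicator[OF that v] by simp
  have zero: "(LINT x|lebesgue. indicator S x * v x) = 0" if "S \<in> sets borel" for S
  proof -
    let ?G = "range (\<lambda>(a, b). box a b :: 'a set)"
    have G: "sigma_sets UNIV ?G = sets borel"
      unfolding borel_eq_box by (rule sets_measure_of[symmetric]) simp
    \<comment> \<open>The complement step of the induction needs the integral over the whole space,
      which is no box; cubes exhausting the space supply it.\<close>
    have total: "(LINT x|lebesgue. v x) = 0"
    proof -
      have "(\<lambda>n::nat. LINT x|lebesgue. indicator (box (- real n *\<^sub>R One) (real n *\<^sub>R One)) x * v x)
          \<longlonglongrightarrow> (LINT x|lebesgue. v x)"
      proof (rule integral_dominated_convergence[where w = "\<lambda>x. \<bar>v x\<bar>"])
        show "AE x in lebesgue. (\<lambda>n. indicator (box (- real n *\<^sub>R One) (real n *\<^sub>R One)) x * v x) \<longlonglongrightarrow> v x"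
        proof (intro AE_I2 tendsto_eventually)
          fix x :: 'a
          obtain N :: nat where N: "norm x < real N" using reals_Archimedean2 by blast
          have "x \<in> box (- real n *\<^sub>R One) (real n *\<^sub>R One)" if "n \<ge> N" for n
            using N that Basis_le_norm[of _ x] by (fastforce simp: mem_box abs_le_iff)
          then show "\<forall>\<^sub>F n in sequentially. indicator (box (- real n *\<^sub>R One) (real n *\<^sub>R One)) x * v x = v x"
            unfolding eventually_sequentially indicator_def by (intro exI[of _ N]) simp
        qed
        show "(\<lambda>x. indicator (box (- real n *\<^sub>R One) (real n *\<^sub>R One)) x * v x) \<in> borel_measurable lebesgue"
          for n :: nat
          by (rule borel_measurable_integrable[OF int]) simp
      qed (use v in \<open>auto simp: indicator_def\<close>)
      then show ?thesis
        by (simp only: box LIMSEQ_const_iff)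
    qed
    have "Int_stable ?G"
      by (auto simp: Int_stable_def box_Int_box)
    moreover have "?G \<subseteq> Pow UNIV" by simp
    moreover have "S \<in> sigma_sets UNIV ?G" using that G by simp
    ultimately show ?thesis
    proof (induction rule: sigma_sets_induct_disjoint)
      case (compl A)
      have "A \<in> sets lebesgue" using compl(1) unfolding G by auto
      have "(LINT x|lebesgue. indicator (UNIV - A) x * v x)
          = (LINT x|lebesgue. v x - indicator A x * v x)"
        by (rule Bochner_Integration.integral_cong) (auto simp: indicator_def)
      also have "\<dots> = 0"
        using compl(2) total by (simp add: Bochner_Integration.integral_diff v int \<open>A \<in> sets lebesgue\<close>)
      finally show ?case .
    next
      case (union A)
      have A: "A i \<in> sets lebesgue" for i using union(2) unfolding G by auto
      have "(LINT x:(\<Union>i. A i)|lebesgue. v x) = (\<Sum>i. (LINT x:(A i)|lebesgue. v x))"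
        using union(1) A int[of "\<Union>i. A i"]
        by (intro lebesgue_integral_countable_add) (auto simp: disjoint_family_on_def set_integrable_def)
      with union(3) show ?case by (simp add: set_lebesgue_integral_def)
    qed (auto simp: box)
  qed
  from \<open>A \<in> sets lebesgue\<close> obtain S N N' where SN: "A = S \<union> N" "N \<subseteq> N'" "N' \<in> null_sets lborel" "S \<in> sets lborel"
    by (rule sets_completionE)
  \<comment> \<open>A Lebesgue set differs from a Borel set by part of a null set, which changes no
    integral.\<close>
  have "AE x in lebesgue. x \<notin> N'"
    using SN(3) by (intro AE_not_in) (rule null_sets_completionI)
  then have "AE x in lebesgue. indicator A x * v x = indicator S x * v x"
    by eventually_elim (use SN(1,2) in \<open>auto simp: indicator_def\<close>)
  then have "(LINT x|lebesgue. indicator A x * v x) = (LINT x|lebesgue. indicator S x * v x)"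
    using SN \<open>A \<in> sets lebesgue\<close> by (intro integral_cong_AE borel_measurable_integrable int) auto
  with zero SN(4) show "set_lebesgue_integral lebesgue A v = set_lebesgue_integral lebesgue A (\<lambda>x. 0)"
    by (simp add: set_lebesgue_integral_def)
qed

text \<open>Boxes that leave \<Omega> are out of reach of the test functions. Cutting
  \<open>u\<close> off to \<open>box p q\<close> with \<open>cbox p q\<close> inside \<Omega> avoids
  them: every box meets \<open>box p q\<close> in a box whose closed version still lies in \<Omega>,
  so all box integrals of the cut-off function vanish. Countably many such closed boxes cover
  \<Omega>.\<close>

lemma AE_zero_if_orthogonal_to_test_functions:
  fixes u :: "real^'d \<Rightarrow> real"
  assumes "open \<Omega>" and u: "integrable (lebesgue_on \<Omega>) u"
    and ortho: "\<And>\<psi>. \<psi> \<in> test_functions \<Omega> \<Longrightarrow> (LINT x|lebesgue_on \<Omega>. u x * \<psi> x) = 0"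
  shows "AE x in lebesgue_on \<Omega>. u x = 0"
proof -
  have S: "\<Omega> \<in> sets lebesgue" using \<open>open \<Omega>\<close> by auto
  define v where "v = (\<lambda>x. if x \<in> \<Omega> then u x else 0)"
  have v: "integrable lebesgue v"
    using u S by (simp add: v_def Lebesgue_Measure.integrable_restrict_UNIV)
  have local: "AE x in lebesgue. x \<in> cbox p q \<longrightarrow> v x = 0" if pq: "cbox p q \<subseteq> \<Omega>" for p q
  proof -
    have "AE x in lebesgue. indicator (box p q) x * v x = 0"
    proof (rule AE_zero_if_box_integrals_zero)
      show "integrable lebesgue (\<lambda>x. indicator (box p q) x * v x)"
        using integrable_mult_indicator[OF _ v, of "box p q"] by simp
      fix a b
      obtain c d where cd: "box a b \<inter> box p q = box c d" "cbox c d \<subseteq> cbox p q"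
      proof
        show "box a b \<inter> box p q = box (\<chi> i. max (a $ i) (p $ i)) (\<chi> i. min (b $ i) (q $ i))"
          by (rule set_eqI) (simp add: mem_box_cart all_conj_distrib conj_ac)
        show "cbox (\<chi> i. max (a $ i) (p $ i)) (\<chi> i. min (b $ i) (q $ i)) \<subseteq> cbox p q"
          by (rule subsetI) (simp add: mem_box_cart)
      qed
      have "(LINT x|lebesgue. indicator (box a b) x * (indicator (box p q) x * v x))
          = (LINT x|lebesgue. (if x \<in> \<Omega> then u x * indicator (box c d) x else 0))"
        using cd by (intro Bochner_Integration.integral_cong refl) (auto simp: v_def indicator_def)
      also have "\<dots> = (LINT x|lebesgue_on \<Omega>. u x * indicator (box c d) x)"
        by (rule Lebesgue_Measure.integral_restrict_UNIV[OF S])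
      also have "\<dots> = 0"
        using cd pq by (intro integral_indicator_box_eq_0 assms) auto
      finally show "(LINT x|lebesgue. indicator (box a b) x * (indicator (box p q) x * v x)) = 0" .
    qed
    \<comment> \<open>The cover used below consists of closed boxes, whereas the cut-off sees the
      open one; the faces are negligible.\<close>
    moreover have "AE x in lebesgue. x \<notin> cbox p q - box p q"
      using negligible_frontier_interval[of p q]
      by (intro AE_not_in) (simp add: negligible_iff_null_sets)
    ultimately show ?thesis
      by eventually_elim (auto simp: indicator_def)
  qed
  obtain \<D> where \<D>: "countable \<D>" "\<D> \<subseteq> Pow \<Omega>" "\<And>X. X \<in> \<D> \<Longrightarrow> \<exists>a b. X = cbox a b" "\<Union>\<D> = \<Omega>"
    using open_countable_Union_open_cbox[OF \<open>open \<Omega>\<close>] by metis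
  have "AE x in lebesgue. \<forall>X\<in>\<D>. x \<in> X \<longrightarrow> v x = 0"
  proof (rule AE_ball_countable'[OF _ \<D>(1)])
    fix X assume X: "X \<in> \<D>"
    obtain p q where "X = cbox p q" using \<D>(3)[OF X] by auto
    moreover have "X \<subseteq> \<Omega>" using X \<D>(2) by auto
    ultimately show "AE x in lebesgue. x \<in> X \<longrightarrow> v x = 0"
      using local[of p q] by simp
  qed
  then have "AE x in lebesgue. x \<in> \<Omega> \<longrightarrow> u x = 0"
  proof eventually_elim
    case (elim x)
    with \<D>(4) show ?case by (metis UnionE v_def)
  qed
  then show ?thesis
    using S by (simp add: AE_restrict_space_iff)
qed

section \<open>Square-integrable functions and weak gradients\<close>

lemma L2_D:
  assumes "f \<in> L2 \<Omega>"
  shows "f \<in> borel_measurable (lebesgue_on \<Omega>)" "integrable (lebesgue_on \<Omega>) (\<lambda>x. (norm (f x))\<^sup>2)"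
  using assms by (auto simp: L2_def)

lemma L2_inner_integrable:
  assumes "f \<in> L2 \<Omega>" "g \<in> L2 \<Omega>"
  shows "integrable (lebesgue_on \<Omega>) (\<lambda>x. f x \<bullet> g x)"
proof (rule Bochner_Integration.integrable_bound)
  show "integrable (lebesgue_on \<Omega>) (\<lambda>x. (norm (f x))\<^sup>2 + (norm (g x))\<^sup>2)"
    using assms by (auto simp: L2_def)
  show "(\<lambda>x. f x \<bullet> g x) \<in> borel_measurable (lebesgue_on \<Omega>)"
    using assms by (auto simp: L2_def)
  show "AE x in lebesgue_on \<Omega>. norm (f x \<bullet> g x) \<le> norm ((norm (f x))\<^sup>2 + (norm (g x))\<^sup>2)"
  proof (rule AE_I2)
    fix x
    have "\<bar>f x \<bullet> g x\<bar> \<le> norm (f x) * norm (g x)"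
      by (rule Cauchy_Schwarz_ineq2)
    also have "\<dots> \<le> (norm (f x))\<^sup>2 + (norm (g x))\<^sup>2"
      using sum_squares_bound[of "norm (f x)" "norm (g x)"]
        mult_nonneg_nonneg[OF norm_ge_zero[of "f x"] norm_ge_zero[of "g x"]]
      by linarith
    finally show "norm (f x \<bullet> g x) \<le> norm ((norm (f x))\<^sup>2 + (norm (g x))\<^sup>2)"
      by simp
  qed
qed

lemma L2_mult_integrable:
  fixes f g :: "real^'d \<Rightarrow> real"
  shows "f \<in> L2 \<Omega> \<Longrightarrow> g \<in> L2 \<Omega> \<Longrightarrow> integrable (lebesgue_on \<Omega>) (\<lambda>x. f x * g x)"
  using L2_inner_integrable[of f \<Omega> g] by simp

lemma L2_diff:
  assumes "f \<in> L2 \<Omega>" "g \<in> L2 \<Omega>"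
  shows "(\<lambda>x. f x - g x) \<in> L2 \<Omega>"
proof -
  have "integrable (lebesgue_on \<Omega>) (\<lambda>x. (norm (f x))\<^sup>2 - 2 * (f x \<bullet> g x) + (norm (g x))\<^sup>2)"
    using assms L2_inner_integrable[OF assms] by (auto simp: L2_def)
  also have "(\<lambda>x. (norm (f x))\<^sup>2 - 2 * (f x \<bullet> g x) + (norm (g x))\<^sup>2) = (\<lambda>x. (norm (f x - g x))\<^sup>2)"
    by (auto simp: power2_norm_eq_inner algebra_simps inner_commute)
  finally show ?thesis
    using assms by (auto simp: L2_def)
qed

lemma L2_bounded:
  fixes f :: "real^'d \<Rightarrow> 'b::euclidean_space"
  assumes "\<Omega> \<in> lmeasurable" and f: "f \<in> borel_measurable (lebesgue_on \<Omega>)"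
    and bound: "AE x in lebesgue_on \<Omega>. norm (f x) \<le> B"
  shows "f \<in> L2 \<Omega>"
proof -
  have "finite_measure (lebesgue_on \<Omega>)"
    using assms(1) by (rule finite_measure_lebesgue_on)
  then have "integrable (lebesgue_on \<Omega>) (\<lambda>x. (norm (f x))\<^sup>2)"
    by (rule finite_measure.integrable_const_bound[where B = "B\<^sup>2"])
      (use f bound in \<open>auto elim!: eventually_mono intro: power_mono\<close>)
  with f show ?thesis by (simp add: L2_def)
qed

lemma L2_integrable:
  fixes f :: "real^'d \<Rightarrow> real"
  assumes "\<Omega> \<in> lmeasurable" "f \<in> L2 \<Omega>"
  shows "integrable (lebesgue_on \<Omega>) f"
  using L2_mult_integrable[OF assms(2) L2_bounded[OF assms(1), of "\<lambda>x. 1" 1]] by simp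

lemma L2_vec_nth:
  fixes g :: "real^'d \<Rightarrow> real^'n"
  assumes "g \<in> L2 \<Omega>"
  shows "(\<lambda>x. g x $ i) \<in> L2 \<Omega>"
proof -
  have meas: "(\<lambda>x. g x $ i) \<in> borel_measurable (lebesgue_on \<Omega>)"
    by (rule measurable_compose[OF L2_D(1)[OF assms]]) simp
  have "integrable (lebesgue_on \<Omega>) (\<lambda>x. (norm (g x $ i))\<^sup>2)"
    by (rule Bochner_Integration.integrable_bound[OF L2_D(2)[OF assms]])
      (use meas component_le_norm_cart[of _ i] in \<open>auto intro!: abs_le_square_iff[THEN iffD1]\<close>)
  with meas show ?thesis by (simp add: L2_def)
qed

lemma L2_inner_self_nonneg: "L2_inner \<Omega> f f \<ge> 0"
  by (simp add: L2_inner_def)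

lemma L2_norm_nonneg: "L2_norm \<Omega> f \<ge> 0"
  by (simp add: L2_norm_def L2_inner_self_nonneg)

lemma L2_norm_power2: "(L2_norm \<Omega> f)\<^sup>2 = L2_inner \<Omega> f f"
  by (simp add: L2_norm_def L2_inner_self_nonneg)

lemma L2_inner_diff_left:
  assumes "f \<in> L2 \<Omega>" "g \<in> L2 \<Omega>" "h \<in> L2 \<Omega>"
  shows "L2_inner \<Omega> (\<lambda>x. f x - g x) h = L2_inner \<Omega> f h - L2_inner \<Omega> g h"
  using assms by (simp add: L2_inner_def inner_diff_left L2_inner_integrable)

text \<open>The squared norm of \<open>f - s g\<close> is a nonnegative quadratic in
  \<open>s\<close>, to be evaluated at its minimiser \<open>b / a\<close>. Because
  \<open>L2_inner\<close> is only semidefinite on functions, \<open>a = 0\<close> does not mean that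
  \<open>g\<close> is 0 and needs its own argument.\<close>

lemma L2_Cauchy_Schwarz:
  assumes "f \<in> L2 \<Omega>" "g \<in> L2 \<Omega>"
  shows "\<bar>L2_inner \<Omega> f g\<bar> \<le> L2_norm \<Omega> f * L2_norm \<Omega> g"
proof -
  define a b c where "a = L2_inner \<Omega> g g" and "b = L2_inner \<Omega> f g" and "c = L2_inner \<Omega> f f"
  have quad: "0 \<le> c - 2 * s * b + s\<^sup>2 * a" for s
  proof -
    have "0 \<le> (LINT x|lebesgue_on \<Omega>. (norm (f x - s *\<^sub>R g x))\<^sup>2)" by simp
    also have "\<dots> = (LINT x|lebesgue_on \<Omega>. f x \<bullet> f x - 2 * s * (f x \<bullet> g x) + s\<^sup>2 * (g x \<bullet> g x))"
      by (rule Bochner_Integration.integral_cong)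
        (simp_all add: power2_norm_eq_inner algebra_simps inner_commute power2_eq_square[of s])
    also have "\<dots> = c - 2 * s * b + s\<^sup>2 * a"
      using assms by (simp add: a_def b_def c_def L2_inner_def L2_inner_integrable)
    finally show ?thesis .
  qed
  have "b\<^sup>2 \<le> c * a"
  proof (cases "a = 0")
    case True
    have "b = 0"
    proof (rule ccontr)
      assume "b \<noteq> 0"
      \<comment> \<open>For \<open>a = 0\<close> the quadratic is affine in \<open>s\<close>, and at
        this \<open>s\<close> it takes the value \<open>c - (c + 1) = -1\<close>.\<close>
      with quad[of "(c + 1) / (2 * b)"] True show False by simp
    qed
    with True show ?thesis by simp
  next
    case False
    then have "a > 0"
      using L2_inner_self_nonneg[of \<Omega> g] by (simp add: a_def)
    with quad[of "b / a"] show ?thesis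
      by (simp add: field_simps power2_eq_square)
  qed
  then have "\<bar>b\<bar> \<le> sqrt (c * a)" by (intro real_le_rsqrt) simp
  then show ?thesis
    by (simp add: a_def b_def c_def L2_norm_def real_sqrt_mult)
qed

lemma L2_norm_mono:
  fixes f :: "real^'d \<Rightarrow> 'a::euclidean_space" and g :: "real^'d \<Rightarrow> 'b::euclidean_space"
  assumes f: "f \<in> L2 \<Omega>" and g: "g \<in> L2 \<Omega>" and "c \<ge> 0"
    and le: "AE x in lebesgue_on \<Omega>. norm (f x) \<le> c * norm (g x)"
  shows "L2_norm \<Omega> f \<le> c * L2_norm \<Omega> g"
proof -
  have "(LINT x|lebesgue_on \<Omega>. (norm (f x))\<^sup>2) \<le> (LINT x|lebesgue_on \<Omega>. c\<^sup>2 * (norm (g x))\<^sup>2)"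
  proof (rule integral_mono_AE)
    show "AE x in lebesgue_on \<Omega>. (norm (f x))\<^sup>2 \<le> c\<^sup>2 * (norm (g x))\<^sup>2"
      using le by eventually_elim (metis norm_ge_zero power_mono power_mult_distrib)
  qed (use f g in \<open>auto simp: L2_def\<close>)
  then have "(L2_norm \<Omega> f)\<^sup>2 \<le> (c * L2_norm \<Omega> g)\<^sup>2"
    by (simp add: L2_norm_power2 L2_inner_def power_mult_distrib power2_norm_eq_inner)
  then show ?thesis
    using \<open>c \<ge> 0\<close> L2_norm_nonneg[of \<Omega> g] by (auto intro: power2_le_imp_le)
qed

section \<open>Test functions and uniqueness of weak gradients\<close>

text \<open>Off its closed support the function is locally 0, hence so is its derivative. The
  closure property makes the derivatives bounded and square integrable, so that the integrals in
  \<open>weak_gradient\<close> can be split.\<close>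

lemma partial_deriv_test_function:
  assumes \<psi>: "\<psi> \<in> test_functions \<Omega>"
  shows "partial_deriv i \<psi> \<in> test_functions \<Omega>"
proof -
  let ?K = "closure {x. \<psi> x \<noteq> 0}"
  have zero: "partial_deriv i \<psi> x = 0" if "x \<notin> ?K" for x
  proof -
    have "(\<psi> has_derivative (\<lambda>h. 0)) (at x)"
      by (rule has_derivative_transform_within_open[where f = "\<lambda>x. 0" and s = "- ?K"])
        (use that closure_subset[of "{x. \<psi> x \<noteq> 0}"] in auto)
    from partial_deriv_eq[OF this] show ?thesis .
  qed
  then have sub: "closure {x. partial_deriv i \<psi> x \<noteq> 0} \<subseteq> ?K"
    by (intro closure_minimal) auto
  moreover have "compact (closure {x. partial_deriv i \<psi> x \<noteq> 0})"
  proof -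
    have "closure {x. partial_deriv i \<psi> x \<noteq> 0} = ?K \<inter> closure {x. partial_deriv i \<psi> x \<noteq> 0}"
      using sub by blast
    also have "compact \<dots>"
      using \<psi> by (intro compact_Int_closed) (auto simp: test_functions_def)
    finally show ?thesis .
  qed
  moreover have "C_differentiable k (partial_deriv i \<psi>)" for k
    using \<psi> C_differentiable.simps(2)[of k \<psi>] by (simp add: test_functions_def del: C_differentiable.simps)
  ultimately show ?thesis
    using \<psi> unfolding test_functions_def by blast
qed

lemma test_function_zero_outside: "\<psi> \<in> test_functions \<Omega> \<Longrightarrow> x \<notin> \<Omega> \<Longrightarrow> \<psi> x = 0"
  using closure_subset[of "{x. \<psi> x \<noteq> 0}"] unfolding test_functions_def by blast

lemma test_function_bounded:
  assumes \<psi>: "\<psi> \<in> test_functions \<Omega>"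
  obtains B where "\<And>x. \<bar>\<psi> x\<bar> \<le> B"
proof -
  let ?K = "closure {x. \<psi> x \<noteq> 0}"
  have "bounded (\<psi> ` ?K)"
    using \<psi> by (intro compact_imp_bounded compact_continuous_image test_function_continuous_on)
      (auto simp: test_functions_def)
  then obtain B where "B > 0" "\<And>x. x \<in> ?K \<Longrightarrow> \<bar>\<psi> x\<bar> \<le> B"
    by (auto simp: bounded_pos)
  moreover have "\<psi> x = 0" if "x \<notin> ?K" for x
    using that closure_subset[of "{x. \<psi> x \<noteq> 0}"] by auto
  ultimately have "\<bar>\<psi> x\<bar> \<le> B" for x
    by (metis abs_zero less_imp_le)
  then show ?thesis by (rule that)
qed

lemma test_function_L2:
  assumes "open \<Omega>" "bounded \<Omega>" "\<psi> \<in> test_functions \<Omega>"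
  shows "\<psi> \<in> L2 \<Omega>"
proof -
  obtain B where "\<And>x. \<bar>\<psi> x\<bar> \<le> B" using test_function_bounded assms by blast
  then show ?thesis
    using assms by (intro L2_bounded[where B = B] continuous_imp_measurable_on_sets_lebesgue
        test_function_continuous_on) (auto intro: bounded_set_imp_lmeasurable)
qed

lemma weak_gradient_diff:
  assumes \<Omega>: "open \<Omega>" "bounded \<Omega>"
    and L2: "u \<in> L2 \<Omega>" "v \<in> L2 \<Omega>" "g \<in> L2 \<Omega>" "k \<in> L2 \<Omega>"
    and wg: "weak_gradient \<Omega> u g" "weak_gradient \<Omega> v k"
  shows "weak_gradient \<Omega> (\<lambda>x. u x - v x) (\<lambda>x. g x - k x)"
  unfolding weak_gradient_def
proof (intro ballI allI)
  fix \<psi> i assume \<psi>: "\<psi> \<in> test_functions \<Omega>"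
  note t = test_function_L2[OF \<Omega> \<psi>] test_function_L2[OF \<Omega> partial_deriv_test_function[OF \<psi>]]
  show "(LINT x|lebesgue_on \<Omega>. (u x - v x) * partial_deriv i \<psi> x)
      = - (LINT x|lebesgue_on \<Omega>. (g x - k x) $ i * \<psi> x)"
    using wg \<psi> by (simp add: left_diff_distrib L2_mult_integrable t L2 L2_vec_nth weak_gradient_def)
qed

text \<open>Subtracting the two defining identities makes every component of \<open>g - k\<close>
  orthogonal to the test functions. Boundedness of \<Omega> turns square integrability into the
  integrability that the fundamental lemma asks for.\<close>

lemma weak_gradient_unique:
  assumes \<Omega>: "open \<Omega>" "bounded \<Omega>"
    and L2: "g \<in> L2 \<Omega>" "k \<in> L2 \<Omega>"
    and wg: "weak_gradient \<Omega> u g" "weak_gradient \<Omega> u k"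
  shows "AE x in lebesgue_on \<Omega>. g x = k x"
proof -
  have "AE x in lebesgue_on \<Omega>. g x $ i - k x $ i = 0" for i
  proof (rule AE_zero_if_orthogonal_to_test_functions[OF \<Omega>(1)])
    show "integrable (lebesgue_on \<Omega>) (\<lambda>x. g x $ i - k x $ i)"
      using \<Omega> by (intro L2_integrable L2_diff L2_vec_nth L2)
        (auto intro: bounded_set_imp_lmeasurable)
    fix \<psi> assume \<psi>: "\<psi> \<in> test_functions \<Omega>"
    note t = test_function_L2[OF \<Omega> \<psi>]
    show "(LINT x|lebesgue_on \<Omega>. (g x $ i - k x $ i) * \<psi> x) = 0"
      using wg \<psi> by (simp add: left_diff_distrib L2_mult_integrable t L2 L2_vec_nth weak_gradient_def)
  qed
  then have "AE x in lebesgue_on \<Omega>. \<forall>i\<in>UNIV. g x $ i - k x $ i = 0"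
    by (intro AE_finite_allI) auto
  then show ?thesis
    by eventually_elim (simp add: vec_eq_iff)
qed

lemma grad_H1:
  assumes "u \<in> H1 \<Omega>"
  shows "grad \<Omega> u \<in> L2 \<Omega>" "weak_gradient \<Omega> u (grad \<Omega> u)"
proof -
  have "\<exists>g. g \<in> L2 \<Omega> \<and> weak_gradient \<Omega> u g"
    using assms by (auto simp: H1_def)
  from someI_ex[OF this] show "grad \<Omega> u \<in> L2 \<Omega>" "weak_gradient \<Omega> u (grad \<Omega> u)"
    by (auto simp: grad_def)
qed

lemma H1_diff:
  assumes \<Omega>: "open \<Omega>" "bounded \<Omega>" and uv: "u \<in> H1 \<Omega>" "v \<in> H1 \<Omega>"
  shows "(\<lambda>x. u x - v x) \<in> H1 \<Omega>"
    and "AE x in lebesgue_on \<Omega>. grad \<Omega> (\<lambda>x. u x - v x) x = grad \<Omega> u x - grad \<Omega> v x"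
proof -
  have "u \<in> L2 \<Omega>" "v \<in> L2 \<Omega>"
    using uv by (auto simp: H1_def)
  with uv have wg: "weak_gradient \<Omega> (\<lambda>x. u x - v x) (\<lambda>x. grad \<Omega> u x - grad \<Omega> v x)"
    by (intro weak_gradient_diff[OF \<Omega>] grad_H1)
  have L2: "(\<lambda>x. grad \<Omega> u x - grad \<Omega> v x) \<in> L2 \<Omega>"
    using uv by (intro L2_diff grad_H1)
  show H1: "(\<lambda>x. u x - v x) \<in> H1 \<Omega>"
    using wg L2 L2_diff[OF \<open>u \<in> L2 \<Omega>\<close> \<open>v \<in> L2 \<Omega>\<close>] by (auto simp: H1_def)
  show "AE x in lebesgue_on \<Omega>. grad \<Omega> (\<lambda>x. u x - v x) x = grad \<Omega> u x - grad \<Omega> v x"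
    by (rule weak_gradient_unique[OF \<Omega> _ L2 _ wg]) (intro grad_H1 H1)+
qed

section \<open>Integration by parts for Lipschitz functions\<close>

text \<open>The pieces may be far from convex, so the argument is carried out along the segment
  \<open>\<gamma>\<close> from \<open>x\<close> to \<open>y\<close>. The preimages of the pieces are
  finitely many closed sets covering \<open>{0..1}\<close>, and on each of them the function
  restricts an affine one with slope at most \<open>L * norm (y - x)\<close> in absolute value. The
  sum \<open>L\<close> is a crude common bound for all gradients.\<close>

lemma lipschitz_on_closed_pieces:
  fixes f :: "'a::real_inner \<Rightarrow> real"
  assumes "finite I" and cover: "\<Union>I = UNIV"
    and closed: "\<And>S. S \<in> I \<Longrightarrow> closed S"
    and affine: "\<And>S. S \<in> I \<Longrightarrow> \<exists>a b. \<forall>x\<in>S. f x = a \<bullet> x + b"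
  shows "\<exists>L. L-lipschitz_on UNIV f"
proof -
  obtain a b where ab: "\<And>S x. S \<in> I \<Longrightarrow> x \<in> S \<Longrightarrow> f x = a S \<bullet> x + b S"
    using affine by metis
  define L where "L = (\<Sum>S\<in>I. norm (a S))"
  have aL: "norm (a S) \<le> L" if "S \<in> I" for S
    unfolding L_def using that \<open>finite I\<close> by (intro member_le_sum) auto
  have "L \<ge> 0" by (simp add: L_def sum_nonneg)
  have "L-lipschitz_on UNIV f"
  proof (rule lipschitz_onI[OF _ \<open>L \<ge> 0\<close>])
    fix x y :: 'a
    define \<gamma> where "\<gamma> = (\<lambda>t::real. x + t *\<^sub>R (y - x))"
    have "(L * norm (y - x))-lipschitz_on {0..1} (\<lambda>t. f (\<gamma> t))"
    proof (rule lipschitz_on_closed_Union[where U = "\<lambda>S. \<gamma> -` S" and I = I])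
      fix S assume S: "S \<in> I"
      show "closed (\<gamma> -` S)"
        by (intro continuous_closed_vimage closed S) (simp add: \<gamma>_def)
      show "(L * norm (y - x))-lipschitz_on (\<gamma> -` S) (\<lambda>t. f (\<gamma> t))"
      proof (rule lipschitz_onI)
        fix s t assume "s \<in> \<gamma> -` S" "t \<in> \<gamma> -` S"
        then have "f (\<gamma> s) - f (\<gamma> t) = (s - t) * (a S \<bullet> (y - x))"
          using ab[OF S] by (simp add: \<gamma>_def algebra_simps)
        then have "dist (f (\<gamma> s)) (f (\<gamma> t)) = \<bar>s - t\<bar> * \<bar>a S \<bullet> (y - x)\<bar>"
          by (simp add: dist_real_def abs_mult)
        also have "\<dots> \<le> \<bar>s - t\<bar> * (norm (a S) * norm (y - x))"
          by (intro mult_left_mono Cauchy_Schwarz_ineq2) auto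
        also have "\<dots> \<le> \<bar>s - t\<bar> * (L * norm (y - x))"
          by (intro mult_left_mono mult_right_mono aL S) auto
        finally show "dist (f (\<gamma> s)) (f (\<gamma> t)) \<le> L * norm (y - x) * dist s t"
          by (simp add: dist_real_def mult.commute)
      qed (simp add: \<open>L \<ge> 0\<close>)
    next
      show "{0..1} \<subseteq> (\<Union>S\<in>I. \<gamma> -` S)"
        using cover by auto
    qed (use \<open>finite I\<close> \<open>L \<ge> 0\<close> in auto)
    from lipschitz_onD[OF this, of 0 1] show "dist (f x) (f y) \<le> L * dist x y"
      by (simp add: \<gamma>_def dist_norm norm_minus_commute)
  qed
  then show ?thesis by blast
qed

text \<open>By Rademacher's theorem the last conjunct is redundant.\<close>

definition bounded_lipschitz :: "(real^'d \<Rightarrow> real) \<Rightarrow> bool" where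
  "bounded_lipschitz f \<longleftrightarrow> bounded (range f) \<and> (\<exists>L. L-lipschitz_on UNIV f) \<and>
     (AE x in lebesgue. f differentiable at x)"

lemma bounded_lipschitzE:
  assumes "bounded_lipschitz f"
  obtains B L where "B \<ge> 0" "L \<ge> 0" "\<And>x. \<bar>f x\<bar> \<le> B" "\<And>x y. \<bar>f x - f y\<bar> \<le> L * norm (x - y)"
proof -
  obtain L where L: "L-lipschitz_on UNIV f"
    using assms by (auto simp: bounded_lipschitz_def)
  obtain B where "B > 0" "\<And>x. \<bar>f x\<bar> \<le> B"
    using assms by (auto simp: bounded_lipschitz_def bounded_pos)
  moreover have "L \<ge> 0" using lipschitz_on_nonneg[OF L] .
  moreover have "\<bar>f x - f y\<bar> \<le> L * norm (x - y)" for x y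
    using lipschitz_on_normD[OF L, of x y] by simp
  ultimately show ?thesis
    using that[of B L] by simp
qed

lemma bounded_lipschitzI:
  assumes "\<And>x. \<bar>f x\<bar> \<le> B" "\<And>x y. \<bar>f x - f y\<bar> \<le> L * norm (x - y)"
    and "AE x in lebesgue. f differentiable at x"
  shows "bounded_lipschitz f"
proof -
  \<comment> \<open>The estimate at two points of distance 1 forces \<open>L\<close> to be
    nonnegative, as \<open>lipschitz_on\<close> demands.\<close>
  have "0 \<le> L * norm (axis undefined 1 - 0 :: real^'a)"
    by (rule order_trans[OF abs_ge_zero assms(2)])
  then have "L \<ge> 0" by simp
  with assms(2) have "L-lipschitz_on UNIV f"
    by (intro lipschitz_onI) (auto simp: dist_norm)
  with assms(1,3) show ?thesis
    by (auto simp: bounded_lipschitz_def bounded_iff)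
qed

lemma bounded_lipschitz_AE_differentiable:
  "bounded_lipschitz f \<Longrightarrow> AE x in lebesgue. f differentiable at x"
  by (simp add: bounded_lipschitz_def)

lemma bounded_lipschitz_continuous_on: "bounded_lipschitz f \<Longrightarrow> continuous_on S f"
  by (meson bounded_lipschitz_def continuous_on_subset lipschitz_on_continuous_on subset_UNIV)

lemma bounded_lipschitz_mult:
  assumes "bounded_lipschitz f" "bounded_lipschitz g"
  shows "bounded_lipschitz (\<lambda>x. f x * g x)"
proof -
  obtain B L where f: "B \<ge> 0" "L \<ge> 0" "\<And>x. \<bar>f x\<bar> \<le> B" "\<And>x y. \<bar>f x - f y\<bar> \<le> L * norm (x - y)"
    using bounded_lipschitzE[OF assms(1)] by metis
  obtain C M where g: "C \<ge> 0" "M \<ge> 0" "\<And>x. \<bar>g x\<bar> \<le> C" "\<And>x y. \<bar>g x - g y\<bar> \<le> M * norm (x - y)"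
    using bounded_lipschitzE[OF assms(2)] by metis
  show ?thesis
  proof (rule bounded_lipschitzI)
    show "\<bar>f x * g x\<bar> \<le> B * C" for x
      using f g by (simp add: abs_mult mult_mono)
    show "\<bar>f x * g x - f y * g y\<bar> \<le> (B * M + L * C) * norm (x - y)" for x y
    proof -
      have "f x * g x - f y * g y = f x * (g x - g y) + (f x - f y) * g y"
        by (simp add: algebra_simps)
      then have "\<bar>f x * g x - f y * g y\<bar> \<le> \<bar>f x\<bar> * \<bar>g x - g y\<bar> + \<bar>f x - f y\<bar> * \<bar>g y\<bar>"
        by (metis abs_mult abs_triangle_ineq)
      also have "\<dots> \<le> B * (M * norm (x - y)) + (L * norm (x - y)) * C"
        using f g by (intro add_mono mult_mono) auto
      finally show ?thesis by (simp add: algebra_simps)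
    qed
    have "AE x in lebesgue. f differentiable at x" "AE x in lebesgue. g differentiable at x"
      using assms by (auto simp: bounded_lipschitz_def)
    then show "AE x in lebesgue. (\<lambda>x. f x * g x) differentiable at x"
      by eventually_elim (rule differentiable_mult)
  qed
qed

lemma borel_measurable_lebesgue: "f \<in> borel_measurable borel \<Longrightarrow> f \<in> borel_measurable lebesgue"
  by (simp add: measurable_completion)

text \<open>A fixed sequence of step sizes replaces the full limit, because measurability of limits
  and dominated convergence concern sequences.\<close>

lemma partial_deriv_LIMSEQ:
  assumes "f differentiable at x"
  shows "(\<lambda>n. (f (x + inverse (real (Suc n)) *\<^sub>R axis i 1) - f x) * real (Suc n)) \<longlonglongrightarrow> partial_deriv i f x"
proof -
  have "((\<lambda>h. (f (x + h *\<^sub>R axis i 1) - f x) / h) \<longlongrightarrow> partial_deriv i f x) (at 0)"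
    using partial_deriv_has_real_derivative[OF assms, of i] by (simp add: DERIV_def)
  moreover have "filterlim (\<lambda>n. inverse (real (Suc n))) (at 0) sequentially"
    using LIMSEQ_inverse_real_of_nat by (auto simp: filterlim_at)
  ultimately have "(\<lambda>n. (f (x + inverse (real (Suc n)) *\<^sub>R axis i 1) - f x) / inverse (real (Suc n)))
      \<longlonglongrightarrow> partial_deriv i f x"
    by (rule filterlim_compose)
  then show ?thesis
    by (simp only: divide_inverse inverse_inverse_eq)
qed

lemma abs_difference_quotient_le:
  fixes f :: "real^'d \<Rightarrow> real"
  assumes "\<And>x y. \<bar>f x - f y\<bar> \<le> L * norm (x - y)"
  shows "\<bar>(f (x + inverse (real (Suc n)) *\<^sub>R axis i 1) - f x) * real (Suc n)\<bar> \<le> L"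
proof -
  have "\<bar>f (x + inverse (real (Suc n)) *\<^sub>R axis i 1) - f x\<bar> \<le> L * inverse (real (Suc n))"
    using assms[of "x + inverse (real (Suc n)) *\<^sub>R axis i 1" x] by simp
  then have "\<bar>f (x + inverse (real (Suc n)) *\<^sub>R axis i 1) - f x\<bar> * real (Suc n)
      \<le> L * inverse (real (Suc n)) * real (Suc n)"
    by (rule mult_right_mono) simp
  also have "\<dots> = L" by (simp add: field_simps)
  finally show ?thesis
    by (simp add: abs_mult)
qed

text \<open>Where \<open>f\<close> is not differentiable \<open>partial_deriv\<close> has
  unspecified values, so both claims come from the difference quotients, which are continuous,
  bounded by the Lipschitz constant and convergent almost everywhere. Completeness of
  \<open>lebesgue\<close> carries measurability across the exceptional null set.\<close>

lemma bounded_lipschitz_partial_deriv: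
  fixes f :: "real^'d \<Rightarrow> real"
  assumes f: "bounded_lipschitz f"
  shows "partial_deriv i f \<in> borel_measurable lebesgue"
    and "\<exists>B. AE x in lebesgue. \<bar>partial_deriv i f x\<bar> \<le> B"
proof -
  define q where "q = (\<lambda>n x. (f (x + inverse (real (Suc n)) *\<^sub>R axis i 1) - f x) * real (Suc n))"
  have ae: "AE x in lebesgue. (\<lambda>n. q n x) \<longlonglongrightarrow> partial_deriv i f x"
    unfolding q_def by (rule eventually_mono[OF bounded_lipschitz_AE_differentiable[OF f] partial_deriv_LIMSEQ])
  have "continuous_on UNIV (q n)" for n
    unfolding q_def
    by (intro continuous_intros continuous_on_compose2[OF bounded_lipschitz_continuous_on[OF f]]) auto
  then have meas: "q n \<in> borel_measurable lebesgue" for n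
    by (intro borel_measurable_lebesgue borel_measurable_continuous_onI)
  have "(\<lambda>x. lim (\<lambda>n. q n x)) \<in> borel_measurable lebesgue"
    using meas by (rule borel_measurable_lim_metric)
  moreover have "AE x in lebesgue. lim (\<lambda>n. q n x) = partial_deriv i f x"
    using ae by eventually_elim (rule limI)
  ultimately show "partial_deriv i f \<in> borel_measurable lebesgue"
    by (rule borel_measurable_AE)
  obtain L where L: "\<And>x y. \<bar>f x - f y\<bar> \<le> L * norm (x - y)"
    using bounded_lipschitzE[OF f] by metis
  have "\<bar>q n x\<bar> \<le> L" for n x
    unfolding q_def by (rule abs_difference_quotient_le[OF L])
  with ae have "AE x in lebesgue. \<bar>partial_deriv i f x\<bar> \<le> L"
    by (auto elim!: eventually_mono intro: tendsto_upperbound[OF tendsto_rabs])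
  then show "\<exists>B. AE x in lebesgue. \<bar>partial_deriv i f x\<bar> \<le> B" by blast
qed

lemma lebesgue_integral_translation:
  fixes f :: "'a::euclidean_space \<Rightarrow> real"
  assumes [measurable]: "f \<in> borel_measurable borel"
  shows "(LINT x|lebesgue. f (x + c)) = (LINT x|lebesgue. f x)"
proof -
  have "(LINT x|lebesgue. f x) = (LINT x|distr lborel borel ((+) c). f x)"
    by (simp add: integral_completion lborel_distr_plus)
  also have "\<dots> = (LINT x|lborel. f (x + c))"
    by (subst integral_distr) (auto simp: add.commute)
  finally show ?thesis
    by (simp add: integral_completion)
qed

text \<open>The difference quotients integrate to zero by translation invariance, and they converge
  dominatedly.\<close>

lemma integral_partial_deriv_eq_0:
  fixes f :: "real^'d \<Rightarrow> real"
  assumes f: "bounded_lipschitz f" and supp: "\<And>x. f x \<noteq> 0 \<Longrightarrow> norm x \<le> R"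
  shows "(LINT x|lebesgue. partial_deriv i f x) = 0"
proof -
  define q where "q = (\<lambda>n x. (f (x + inverse (real (Suc n)) *\<^sub>R axis i 1) - f x) * real (Suc n))"
  have ae: "AE x in lebesgue. (\<lambda>n. q n x) \<longlonglongrightarrow> partial_deriv i f x"
    unfolding q_def by (rule eventually_mono[OF bounded_lipschitz_AE_differentiable[OF f] partial_deriv_LIMSEQ])
  have borel[measurable]: "f \<in> borel_measurable borel"
    using f by (intro borel_measurable_continuous_onI bounded_lipschitz_continuous_on)
  obtain B L where BL: "\<And>x. \<bar>f x\<bar> \<le> B" "\<And>x y. \<bar>f x - f y\<bar> \<le> L * norm (x - y)" "L \<ge> 0"
    using bounded_lipschitzE[OF f] by metis
  have indicator: "integrable lebesgue (\<lambda>x::real^'d. c * indicator (cball 0 r) x)" for c r :: real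
    by (intro integrable_mult_right integrable_real_indicator)
      (auto simp: emeasure_lborel_cball_finite[unfolded infinity_ennreal_def])
  have f_int: "integrable lebesgue (\<lambda>x. f (x + c))" for c
  proof (rule Bochner_Integration.integrable_bound[OF indicator[of B "R + norm c"]])
    show "(\<lambda>x. f (x + c)) \<in> borel_measurable lebesgue"
      by (intro borel_measurable_lebesgue) measurable
    have "norm x \<le> R + norm c" if "f (x + c) \<noteq> 0" for x
      using supp[OF that] norm_triangle_ineq4[of "x + c" c] by simp
    then show "AE x in lebesgue. norm (f (x + c)) \<le> norm (B * indicator (cball 0 (R + norm c)) x)"
      using BL(1) by (auto simp: indicator_def intro: order_trans[OF _ abs_ge_self])
  qed
  have "(\<lambda>n. LINT x|lebesgue. q n x) \<longlonglongrightarrow> (LINT x|lebesgue. partial_deriv i f x)"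
  proof (rule integral_dominated_convergence[OF _ _ indicator[of L "R + 1"]])
    show "partial_deriv i f \<in> borel_measurable lebesgue"
      by (rule bounded_lipschitz_partial_deriv[OF f])
    show "q n \<in> borel_measurable lebesgue" for n
      unfolding q_def by (intro borel_measurable_lebesgue) measurable
    have "\<bar>q n x\<bar> \<le> L" for n x
      unfolding q_def by (rule abs_difference_quotient_le[OF BL(2)])
    \<comment> \<open>Step sizes are at most 1, so all quotients vanish outside
      \<open>cball 0 (R + 1)\<close>, and \<open>L\<close> times its indicator is an integrable
      majorant.\<close>
    moreover have "q n x = 0" if "norm x > R + 1" for n x
    proof -
      have "norm x \<le> norm (x + inverse (real (Suc n)) *\<^sub>R axis i 1) + inverse (real (Suc n))"
        using norm_triangle_ineq4[of "x + inverse (real (Suc n)) *\<^sub>R axis i 1" "inverse (real (Suc n)) *\<^sub>R axis i 1"]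
        by simp
      moreover have "inverse (real (Suc n)) \<le> 1"
        by (simp add: inverse_le_1_iff)
      ultimately show ?thesis
        using that supp[of x] supp[of "x + inverse (real (Suc n)) *\<^sub>R axis i 1"]
        by (fastforce simp: q_def)
    qed
    ultimately show "AE x in lebesgue. norm (q n x) \<le> L * indicator (cball 0 (R + 1)) x" for n
      by (intro AE_I2) (auto simp: indicator_def not_le)
  qed (rule ae)
  moreover have "(LINT x|lebesgue. q n x) = 0" for n
    using f_int[of 0] f_int
    by (simp add: q_def lebesgue_integral_translation)
  ultimately show ?thesis
    by (simp add: LIMSEQ_const_iff)
qed

text \<open>The product \<open>f * g\<close> inherits the bounded support of \<open>f\<close>, so
  its partial derivative integrates to 0. Both terms stay under one integral, which leaves their
  separate integrability to the place where they are split.\<close>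

lemma integral_by_parts:
  fixes f g :: "real^'d \<Rightarrow> real"
  assumes f: "bounded_lipschitz f" and g: "bounded_lipschitz g" and supp: "\<And>x. f x \<noteq> 0 \<Longrightarrow> norm x \<le> R"
  shows "(LINT x|lebesgue. f x * partial_deriv i g x + partial_deriv i f x * g x) = 0"
proof -
  have fg: "bounded_lipschitz (\<lambda>x. f x * g x)"
    by (rule bounded_lipschitz_mult[OF f g])
  have "AE x in lebesgue. f differentiable at x" "AE x in lebesgue. g differentiable at x"
    using f g by (auto simp: bounded_lipschitz_def)
  then have "AE x in lebesgue. f x * partial_deriv i g x + partial_deriv i f x * g x
      = partial_deriv i (\<lambda>x. f x * g x) x"
    by eventually_elim (simp add: partial_deriv_mult)
  then have "(LINT x|lebesgue. f x * partial_deriv i g x + partial_deriv i f x * g x)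
      = (LINT x|lebesgue. partial_deriv i (\<lambda>x. f x * g x) x)"
    using bounded_lipschitz_partial_deriv(1)[OF f] bounded_lipschitz_partial_deriv(1)[OF g]
      bounded_lipschitz_partial_deriv(1)[OF fg]
      borel_measurable_lebesgue[OF borel_measurable_continuous_onI[OF bounded_lipschitz_continuous_on[OF f]]]
      borel_measurable_lebesgue[OF borel_measurable_continuous_onI[OF bounded_lipschitz_continuous_on[OF g]]]
    by (intro integral_cong_AE) auto
  also have "\<dots> = 0"
    by (rule integral_partial_deriv_eq_0[OF fg, where R = R]) (use supp in auto)
  finally show ?thesis .
qed

text \<open>The partial derivatives are themselves test functions, hence bounded; the sum of their
  bounds dominates the operator norm of the derivative, and the mean value inequality
  applies.\<close>

lemma test_function_bounded_lipschitz:
  assumes \<psi>: "\<psi> \<in> test_functions \<Omega>"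
  shows "bounded_lipschitz \<psi>"
proof -
  obtain B where B: "\<And>x. \<bar>\<psi> x\<bar> \<le> B" using test_function_bounded[OF \<psi>] by blast
  have "\<exists>C. \<forall>x. \<bar>partial_deriv i \<psi> x\<bar> \<le> C" for i
    using test_function_bounded[OF partial_deriv_test_function[OF \<psi>]] by blast
  then obtain C where C: "\<And>i x. \<bar>partial_deriv i \<psi> x\<bar> \<le> C i" by metis
  have diff: "\<psi> differentiable at x" for x
    using \<psi> C_differentiable.simps(2)[of 0 \<psi>] by (simp add: test_functions_def del: C_differentiable.simps)
  have "norm (\<psi> x - \<psi> y) \<le> (\<Sum>i\<in>UNIV. C i) * norm (x - y)" for x y
  proof (rule differentiable_bound[where S = UNIV and f' = "\<lambda>x. frechet_derivative \<psi> (at x)"])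
    fix x
    show der: "(\<psi> has_derivative frechet_derivative \<psi> (at x)) (at x within UNIV)"
      using diff frechet_derivative_works by blast
    show "onorm (frechet_derivative \<psi> (at x)) \<le> (\<Sum>i\<in>UNIV. C i)"
    proof (rule onorm_le)
      fix h
      have lin: "linear (frechet_derivative \<psi> (at x))"
        using der has_derivative_linear by blast
      have "frechet_derivative \<psi> (at x) h = frechet_derivative \<psi> (at x) (\<Sum>i\<in>UNIV. h $ i *\<^sub>R axis i 1)"
        using basis_expansion[of h] by (simp add: scalar_mult_eq_scaleR)
      also have "\<dots> = (\<Sum>i\<in>UNIV. h $ i * partial_deriv i \<psi> x)"
        by (simp add: linear_sum[OF lin] linear_scale[OF lin] partial_deriv_def)
      finally have "\<bar>frechet_derivative \<psi> (at x) h\<bar> \<le> (\<Sum>i\<in>UNIV. \<bar>h $ i\<bar> * \<bar>partial_deriv i \<psi> x\<bar>)"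
        by (simp add: sum_abs abs_mult[symmetric])
      also have "\<dots> \<le> (\<Sum>i\<in>UNIV. norm h * C i)"
        by (intro sum_mono mult_mono component_le_norm_cart C) auto
      finally show "norm (frechet_derivative \<psi> (at x) h) \<le> (\<Sum>i\<in>UNIV. C i) * norm h"
        by (simp add: sum_distrib_right mult.commute[of "norm h"])
    qed
  qed auto
  with B diff show ?thesis
    by (intro bounded_lipschitzI) auto
qed

text \<open>The coordinate is unbounded, so \<open>bounded_lipschitz_mult\<close> does not apply.
  The bound \<open>R\<close> on the coordinate is available only where \<open>f\<close> is nonzero,
  so the increment is split with the coordinate taken at \<open>x\<close> or at \<open>y\<close>
  according to where \<open>f\<close> does not vanish.\<close>

lemma bounded_lipschitz_coordinate_mult:
  fixes f :: "real^'d \<Rightarrow> real"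
  assumes f: "bounded_lipschitz f" and supp: "\<And>x. f x \<noteq> 0 \<Longrightarrow> norm x \<le> R"
  shows "bounded_lipschitz (\<lambda>x. x $ i * f x)"
proof -
  obtain B L where BL: "B \<ge> 0" "L \<ge> 0" "\<And>x. \<bar>f x\<bar> \<le> B" "\<And>x y. \<bar>f x - f y\<bar> \<le> L * norm (x - y)"
    using bounded_lipschitzE[OF f] by metis
  have R: "\<bar>x $ i\<bar> \<le> R" if "f x \<noteq> 0" for x
    using supp[OF that] component_le_norm_cart[of x i] by linarith
  show ?thesis
  proof (rule bounded_lipschitzI)
    show "\<bar>x $ i * f x\<bar> \<le> \<bar>R\<bar> * B" for x
      using R[of x] BL(1,3) by (cases "f x = 0") (auto simp: abs_mult intro!: mult_mono)
    show "\<bar>x $ i * f x - y $ i * f y\<bar> \<le> (\<bar>R\<bar> * L + B) * norm (x - y)" for x y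
    proof (cases "f x = 0")
      case False
      have "x $ i * f x - y $ i * f y = x $ i * (f x - f y) + (x - y) $ i * f y"
        by (simp add: algebra_simps)
      then have "\<bar>x $ i * f x - y $ i * f y\<bar> \<le> \<bar>x $ i\<bar> * \<bar>f x - f y\<bar> + \<bar>(x - y) $ i\<bar> * \<bar>f y\<bar>"
        by (metis abs_mult abs_triangle_ineq)
      also have "\<dots> \<le> \<bar>R\<bar> * (L * norm (x - y)) + norm (x - y) * B"
        using R[OF False] BL by (intro add_mono mult_mono component_le_norm_cart) auto
      finally show ?thesis by (simp add: algebra_simps)
    next
      case True
      then have "\<bar>x $ i * f x - y $ i * f y\<bar> = \<bar>y $ i\<bar> * \<bar>f x - f y\<bar>"
        by (simp add: abs_mult)
      also have "\<dots> \<le> \<bar>R\<bar> * (L * norm (x - y))"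
      proof (cases "f y = 0")
        case False
        show ?thesis
          using R[OF False] BL(2,4) by (intro mult_mono) auto
      qed (use True BL in simp)
      also have "\<dots> \<le> (\<bar>R\<bar> * L + B) * norm (x - y)"
        using BL by (simp add: algebra_simps)
      finally show ?thesis .
    qed
    have "AE x in lebesgue. f differentiable at x"
      using f by (auto simp: bounded_lipschitz_def)
    then show "AE x in lebesgue. (\<lambda>x. x $ i * f x) differentiable at x"
      by eventually_elim
        (intro differentiable_mult bounded_linear_imp_differentiable[OF bounded_linear_vec_nth])
  qed
qed

section \<open>Poincare inequality on finite element spaces\<close>

text \<open>The closed pieces are the elements and the complement of \<Omega>. Differentiability can
  fail only on the frontiers of the elements, which are null because the elements are convex: any
  other point is interior to an element or lies outside the closure of \<Omega>.\<close>

lemma bounded_lipschitz_zero_extension: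
  fixes \<Omega> :: "(real^'d) set"
  assumes "open \<Omega>" "bounded \<Omega>" "finite \<T>"
    and elem: "\<And>e. e \<in> \<T> \<Longrightarrow> closed e \<and> convex e" and cover: "\<Union>\<T> = closure \<Omega>"
    and zero: "\<And>x. x \<in> frontier \<Omega> \<Longrightarrow> w x = 0"
    and affine: "\<And>e. e \<in> \<T> \<Longrightarrow> \<exists>a b. \<forall>x\<in>e. w x = a \<bullet> x + b"
  shows "bounded_lipschitz (\<lambda>x. if x \<in> \<Omega> then w x else 0)"
proof -
  define W where "W = (\<lambda>x. if x \<in> \<Omega> then w x else 0)"
  define I where "I = insert (- \<Omega>) \<T>"
  \<comment> \<open>Here the boundary condition enters: extension and \<open>w\<close> agree up to
    the frontier, so the affine formula for \<open>W\<close> holds on each whole closed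
    element.\<close>
  have W_closure: "W x = w x" if "x \<in> closure \<Omega>" for x
    using that zero[of x] \<open>open \<Omega>\<close> by (auto simp: W_def frontier_def interior_open)
  have I_affine: "\<exists>a b. \<forall>x\<in>S. W x = a \<bullet> x + b" if "S \<in> I" for S
  proof (cases "S = - \<Omega>")
    case True
    then show ?thesis by (intro exI[of _ 0]) (simp add: W_def)
  next
    case False
    then have S: "S \<in> \<T>" using that by (simp add: I_def)
    then have "\<forall>x\<in>S. W x = w x" using W_closure cover by blast
    then show ?thesis using affine[OF S] by simp
  qed
  have "\<Omega> \<subseteq> \<Union>\<T>" using cover closure_subset by blast
  then have "\<exists>L. L-lipschitz_on UNIV W"
    using \<open>finite \<T>\<close> \<open>open \<Omega>\<close> elem I_affine
    by (intro lipschitz_on_closed_pieces[where I = I]) (auto simp: I_def)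
  moreover from this have "continuous_on (closure \<Omega>) W"
    by (meson continuous_on_subset lipschitz_on_continuous_on subset_UNIV)
  then have "bounded (W ` closure \<Omega>)"
    using \<open>bounded \<Omega>\<close> by (intro compact_imp_bounded compact_continuous_image) auto
  then have "bounded (insert 0 (W ` closure \<Omega>))" by simp
  then have "bounded (range W)"
    by (rule bounded_subset) (use closure_subset[of \<Omega>] in \<open>auto simp: W_def\<close>)
  moreover have "AE x in lebesgue. W differentiable at x"
  proof -
    have "negligible (\<Union>e\<in>\<T>. frontier e)"
      using \<open>finite \<T>\<close> elem by (intro negligible_Union) (auto intro: negligible_convex_frontier)
    then have "AE x in lebesgue. x \<notin> (\<Union>e\<in>\<T>. frontier e)"
      by (intro AE_not_in) (simp add: negligible_iff_null_sets)
    then show ?thesis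
    proof eventually_elim
      case (elim x)
      have "\<exists>S\<in>I. x \<in> interior S"
      proof (cases "x \<in> closure \<Omega>")
        case True
        then obtain e where e: "e \<in> \<T>" "x \<in> e" using cover by blast
        then have "x \<in> interior e"
          using elim elem[OF e(1)] by (auto simp: frontier_def closure_closed)
        with e show ?thesis by (auto simp: I_def)
      next
        case False
        then show ?thesis by (simp add: I_def interior_complement)
      qed
      then obtain S where S: "S \<in> I" "x \<in> interior S" by blast
      obtain a b where ab: "\<forall>x\<in>S. W x = a \<bullet> x + b" using I_affine[OF S(1)] by blast
      have "(W has_derivative (\<lambda>h. a \<bullet> h)) (at x)"
      proof (rule has_derivative_transform_within_open[where f = "\<lambda>x. a \<bullet> x + b" and s = "interior S"])
        show "((\<lambda>x. a \<bullet> x + b) has_derivative (\<lambda>h. a \<bullet> h)) (at x)"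
          by (auto intro!: derivative_eq_intros)
      qed (use ab S interior_subset[of S] in auto)
      then show ?case by (auto simp: differentiable_def)
    qed
  qed
  ultimately show ?thesis
    by (simp add: bounded_lipschitz_def W_def[symmetric])
qed

lemma fe_space_bounded_lipschitz:
  assumes "open \<Omega>" "bounded \<Omega>" "quasi_uniform_triangulation \<Omega> \<sigma> h \<T>" "w \<in> fe_space \<Omega> \<T>"
  shows "bounded_lipschitz (\<lambda>x. if x \<in> \<Omega> then w x else 0)"
proof (rule bounded_lipschitz_zero_extension[OF assms(1,2)])
  show "finite \<T>" "\<Union>\<T> = closure \<Omega>"
    using assms(3) by (auto simp: quasi_uniform_triangulation_def triangulation_def)
  show "closed e \<and> convex e" if "e \<in> \<T>" for e
    using assms(3) that simplex_imp_polytope polytope_imp_closed polytope_imp_convex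
    unfolding quasi_uniform_triangulation_def by blast
qed (use assms(4) in \<open>auto simp: fe_space_def\<close>)

lemma fe_space_diff:
  assumes "open \<Omega>" "bounded \<Omega>" and uv: "u \<in> fe_space \<Omega> \<T>" "v \<in> fe_space \<Omega> \<T>"
  shows "(\<lambda>x. u x - v x) \<in> fe_space \<Omega> \<T>"
proof -
  have "\<exists>a b. \<forall>x\<in>e. u x - v x = a \<bullet> x + b" if "e \<in> \<T>" for e
  proof -
    have "\<exists>a b. \<forall>x\<in>e. u x = a \<bullet> x + b" "\<exists>a b. \<forall>x\<in>e. v x = a \<bullet> x + b"
      using uv that by (simp_all add: fe_space_def)
    then obtain a b a' b' where "\<forall>x\<in>e. u x = a \<bullet> x + b" "\<forall>x\<in>e. v x = a' \<bullet> x + b'"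
      by metis
    then have "\<forall>x\<in>e. u x - v x = (a - a') \<bullet> x + (b - b')"
      by (simp add: inner_diff_left)
    then show ?thesis by blast
  qed
  moreover have "(\<lambda>x. u x - v x) \<in> H1 \<Omega>"
    using uv by (intro H1_diff(1)[OF assms(1,2)]) (auto simp: fe_space_def)
  moreover have "u x - v x = 0" if "x \<in> frontier \<Omega>" for x
    using uv that by (auto simp: fe_space_def)
  ultimately show ?thesis
    unfolding fe_space_def by blast
qed

lemma L2_partial_derivs:
  fixes \<Omega> :: "(real^'d) set"
  assumes \<Omega>: "open \<Omega>" "bounded \<Omega>" and f: "bounded_lipschitz f"
  shows "(\<lambda>x. \<chi> i. partial_deriv i f x) \<in> L2 \<Omega>"
proof -
  let ?G = "\<lambda>x. \<chi> i. partial_deriv i f x"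
  have "\<forall>i. \<exists>B. AE x in lebesgue. \<bar>partial_deriv i f x\<bar> \<le> B"
    using bounded_lipschitz_partial_deriv(2)[OF f] by blast
  then obtain B where "\<And>i. AE x in lebesgue. \<bar>partial_deriv i f x\<bar> \<le> B i" by metis
  then have "AE x in lebesgue. \<forall>i\<in>UNIV. \<bar>partial_deriv i f x\<bar> \<le> B i"
    by (intro AE_finite_allI) auto
  then have "AE x in lebesgue. norm (?G x) \<le> (\<Sum>i\<in>UNIV. B i)"
  proof eventually_elim
    case (elim x)
    have "norm (?G x) \<le> (\<Sum>i\<in>UNIV. \<bar>partial_deriv i f x\<bar>)"
      using norm_le_l1_cart[of "?G x"] by simp
    also have "\<dots> \<le> (\<Sum>i\<in>UNIV. B i)"
      using elim by (intro sum_mono) auto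
    finally show ?case .
  qed
  then have bound: "AE x in lebesgue_on \<Omega>. norm (?G x) \<le> (\<Sum>i\<in>UNIV. B i)"
    using \<open>open \<Omega>\<close> by (simp add: AE_restrict_space_iff eventually_mono)
  have "?G \<in> borel_measurable lebesgue"
  proof (rule borel_measurable_euclidean_space[THEN iffD2], rule ballI)
    fix b :: "real^'d" assume "b \<in> Basis"
    then obtain j where "b = axis j 1" by (auto simp: Basis_vec_def)
    then show "(\<lambda>x. ?G x \<bullet> b) \<in> borel_measurable lebesgue"
      using bounded_lipschitz_partial_deriv(1)[OF f, of j] by (simp add: inner_axis)
  qed
  then have "?G \<in> borel_measurable (lebesgue_on \<Omega>)"
    by (rule measurable_restrict_space1)
  then show ?thesis
    using \<Omega> by (intro L2_bounded[OF _ _ bound] bounded_set_imp_lmeasurable) auto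
qed

text \<open>In the integration by parts the extension supplies the bounded support, and
  \<open>\<psi>\<close> vanishing outside \<Omega> brings the integral back to \<Omega>. The
  extension is differentiated instead of \<open>w\<close>, whose values outside the closure of
  \<Omega> are arbitrary.\<close>

lemma weak_gradient_zero_extension:
  fixes \<Omega> :: "(real^'d) set"
  assumes \<Omega>: "open \<Omega>" "bounded \<Omega>" and w: "w \<in> L2 \<Omega>"
    and W: "bounded_lipschitz (\<lambda>x. if x \<in> \<Omega> then w x else 0)" (is "bounded_lipschitz ?W")
  shows "weak_gradient \<Omega> w (\<lambda>x. \<chi> i. partial_deriv i ?W x)"
  unfolding weak_gradient_def
proof (intro ballI allI)
  fix \<psi> i assume \<psi>: "\<psi> \<in> test_functions \<Omega>"
  obtain R where R: "\<And>x. x \<in> \<Omega> \<Longrightarrow> norm x \<le> R"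
    using \<Omega>(2) by (auto simp: bounded_iff)
  have \<psi>L2: "\<psi> \<in> L2 \<Omega>" "partial_deriv i \<psi> \<in> L2 \<Omega>"
    using test_function_L2[OF \<Omega>] \<psi> partial_deriv_test_function[OF \<psi>] by auto
  have GL2: "partial_deriv i ?W \<in> L2 \<Omega>"
    using L2_vec_nth[OF L2_partial_derivs[OF \<Omega> W], of i] by simp
  have "(LINT x|lebesgue. ?W x * partial_deriv i \<psi> x + partial_deriv i ?W x * \<psi> x) = 0"
    by (rule integral_by_parts[OF W test_function_bounded_lipschitz[OF \<psi>], where R = R])
      (use R in \<open>auto split: if_splits\<close>)
  also have "(LINT x|lebesgue. ?W x * partial_deriv i \<psi> x + partial_deriv i ?W x * \<psi> x)
      = (LINT x|lebesgue. (if x \<in> \<Omega> then w x * partial_deriv i \<psi> x + partial_deriv i ?W x * \<psi> x else 0))"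
    by (intro Bochner_Integration.integral_cong refl) (simp add: test_function_zero_outside[OF \<psi>])
  also have "\<dots> = (LINT x|lebesgue_on \<Omega>. w x * partial_deriv i \<psi> x + partial_deriv i ?W x * \<psi> x)"
    using \<Omega> by (intro Lebesgue_Measure.integral_restrict_UNIV) auto
  also have "\<dots> = (LINT x|lebesgue_on \<Omega>. w x * partial_deriv i \<psi> x)
      + (LINT x|lebesgue_on \<Omega>. partial_deriv i ?W x * \<psi> x)"
    by (intro Bochner_Integration.integral_add L2_mult_integrable w \<psi>L2 GL2)
  finally show "(LINT x|lebesgue_on \<Omega>. w x * partial_deriv i \<psi> x)
      = - (LINT x|lebesgue_on \<Omega>. (\<chi> i. partial_deriv i ?W x) $ i * \<psi> x)"
    by simp
qed

text \<open>Integrating \<open>\<partial>\<^sub>i (x\<^sub>i w\<^sup>2)\<close> over \<open>\<Omega>\<close> gives \<open>\<parallel>w\<parallel>\<^sup>2 = - 2 (x\<^sub>i w, \<partial>\<^sub>i w)\<close>.\<close>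

lemma fe_space_Poincare:
  fixes \<Omega> :: "(real^'d) set"
  assumes \<Omega>: "open \<Omega>" "\<Omega> \<subseteq> cball 0 R" "R > 0"
    and tri: "quasi_uniform_triangulation \<Omega> \<sigma> h \<T>" and w: "w \<in> fe_space \<Omega> \<T>"
  shows "L2_norm \<Omega> w \<le> 2 * R * L2_norm \<Omega> (grad \<Omega> w)"
proof -
  have bdd: "bounded \<Omega>" using \<Omega>(2) bounded_cball bounded_subset by blast
  have H1: "w \<in> H1 \<Omega>" and wL2: "w \<in> L2 \<Omega>"
    using w by (auto simp: fe_space_def H1_def)
  \<comment> \<open>One direction is enough for the inequality; \<open>undefined\<close> just names
    some coordinate.\<close>
  define i :: 'd where "i = undefined"
  define W where "W = (\<lambda>x. if x \<in> \<Omega> then w x else 0)"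
  have W: "bounded_lipschitz W"
    unfolding W_def by (rule fe_space_bounded_lipschitz[OF \<Omega>(1) bdd tri w])
  have supp: "norm x \<le> R" if "W x \<noteq> 0" for x
    using that \<Omega>(2) by (auto simp: W_def split: if_splits)
  let ?G = "\<lambda>x. \<chi> i. partial_deriv i W x"
  have GL2: "?G \<in> L2 \<Omega>" by (rule L2_partial_derivs[OF \<Omega>(1) bdd W])
  have GiL2: "partial_deriv i W \<in> L2 \<Omega>" using L2_vec_nth[OF GL2, of i] by simp
  have grad: "AE x in lebesgue_on \<Omega>. ?G x = grad \<Omega> w x"
    using weak_gradient_zero_extension[OF \<Omega>(1) bdd wL2 W[unfolded W_def]] grad_H1[OF H1] GL2
    by (intro weak_gradient_unique[OF \<Omega>(1) bdd]) (auto simp: W_def)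
  have Gi_le: "L2_norm \<Omega> (partial_deriv i W) \<le> 1 * L2_norm \<Omega> (grad \<Omega> w)"
  proof (rule L2_norm_mono[OF GiL2 grad_H1(1)[OF H1]])
    show "AE x in lebesgue_on \<Omega>. norm (partial_deriv i W x) \<le> 1 * norm (grad \<Omega> w x)"
      using grad
    proof eventually_elim
      case (elim x)
      then have "partial_deriv i W x = grad \<Omega> w x $ i" by (metis vec_lambda_beta)
      then show ?case using component_le_norm_cart[of "grad \<Omega> w x" i] by simp
    qed
  qed simp
  have meas: "(\<lambda>x. x $ i * w x) \<in> borel_measurable (lebesgue_on \<Omega>)"
    using \<Omega>(1) by (intro borel_measurable_times L2_D(1)[OF wL2] continuous_imp_measurable_on_sets_lebesgue)
      (auto intro!: continuous_intros)
  have xw: "norm (x $ i * w x) \<le> R * norm (w x)" if "x \<in> \<Omega>" for x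
    using that \<Omega>(2) component_le_norm_cart[of x i]
    by (auto simp: abs_mult intro!: mult_right_mono)
  have xwL2: "(\<lambda>x. x $ i * w x) \<in> L2 \<Omega>"
  proof -
    have "integrable (lebesgue_on \<Omega>) (\<lambda>x. R\<^sup>2 * (norm (w x))\<^sup>2)"
      using L2_D(2)[OF wL2] by simp
    then have "integrable (lebesgue_on \<Omega>) (\<lambda>x. (norm (x $ i * w x))\<^sup>2)"
    proof (rule Bochner_Integration.integrable_bound)
      show "AE x in lebesgue_on \<Omega>. norm ((norm (x $ i * w x))\<^sup>2) \<le> norm (R\<^sup>2 * (norm (w x))\<^sup>2)"
      proof (rule AE_I2)
        fix x assume "x \<in> space (lebesgue_on \<Omega>)"
        then have "(norm (x $ i * w x))\<^sup>2 \<le> (R * norm (w x))\<^sup>2"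
          by (intro power_mono xw) auto
        then show "norm ((norm (x $ i * w x))\<^sup>2) \<le> norm (R\<^sup>2 * (norm (w x))\<^sup>2)"
          by (simp add: power_mult_distrib)
      qed
    qed (use meas in measurable)
    with meas show ?thesis by (simp add: L2_def)
  qed
  have xw_le: "L2_norm \<Omega> (\<lambda>x. x $ i * w x) \<le> R * L2_norm \<Omega> w"
    using xw \<Omega>(3) by (intro L2_norm_mono[OF xwL2 wL2]) auto
  \<comment> \<open>The factors are \<open>W\<close> and \<open>x $ i * W\<close>; by the product
    rule the term \<open>x $ i * W * partial_deriv i W\<close> occurs twice, next to the square of
    \<open>W\<close>.\<close>
  have "(LINT x|lebesgue. W x * partial_deriv i (\<lambda>x. x $ i * W x) x + partial_deriv i W x * (x $ i * W x)) = 0"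
    by (rule integral_by_parts[OF W bounded_lipschitz_coordinate_mult[OF W supp] supp])
  also have "(LINT x|lebesgue. W x * partial_deriv i (\<lambda>x. x $ i * W x) x + partial_deriv i W x * (x $ i * W x))
      = (LINT x|lebesgue. (if x \<in> \<Omega> then w x * w x + 2 * (x $ i * w x * partial_deriv i W x) else 0))"
  proof (rule integral_cong_AE)
    show "AE x in lebesgue. W x * partial_deriv i (\<lambda>x. x $ i * W x) x + partial_deriv i W x * (x $ i * W x)
      = (if x \<in> \<Omega> then w x * w x + 2 * (x $ i * w x * partial_deriv i W x) else 0)"
      using bounded_lipschitz_AE_differentiable[OF W]
    proof eventually_elim
      case (elim x)
      have "((\<lambda>x. x $ i) has_derivative (\<lambda>h. h $ i)) (at x)"
        by (rule bounded_linear_imp_has_derivative[OF bounded_linear_vec_nth])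
      then have "partial_deriv i (\<lambda>x. x $ i) x = 1" "(\<lambda>x. x $ i) differentiable at x"
        using partial_deriv_eq differentiableI by fastforce+
      with elim have "partial_deriv i (\<lambda>x. x $ i * W x) x = x $ i * partial_deriv i W x + W x"
        by (simp add: partial_deriv_mult)
      then show ?case by (simp add: W_def algebra_simps)
    qed
    have "integrable (lebesgue_on \<Omega>) (\<lambda>x. w x * w x + 2 * (x $ i * w x * partial_deriv i W x))"
      by (intro Bochner_Integration.integrable_add integrable_mult_right L2_mult_integrable wL2 xwL2 GiL2)
    then show "(\<lambda>x. if x \<in> \<Omega> then w x * w x + 2 * (x $ i * w x * partial_deriv i W x) else 0)
        \<in> borel_measurable lebesgue"
      using \<Omega>(1) by (intro borel_measurable_integrable) (simp add: Lebesgue_Measure.integrable_restrict_UNIV)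
    have xW: "bounded_lipschitz (\<lambda>x. x $ i * W x)"
      by (rule bounded_lipschitz_coordinate_mult[OF W supp])
    show "(\<lambda>x. W x * partial_deriv i (\<lambda>x. x $ i * W x) x + partial_deriv i W x * (x $ i * W x))
        \<in> borel_measurable lebesgue"
      by (intro borel_measurable_add borel_measurable_times bounded_lipschitz_partial_deriv(1) W xW
          borel_measurable_lebesgue[OF borel_measurable_continuous_onI] bounded_lipschitz_continuous_on)
  qed
  also have "\<dots> = (LINT x|lebesgue_on \<Omega>. w x * w x + 2 * (x $ i * w x * partial_deriv i W x))"
    using \<Omega> by (intro Lebesgue_Measure.integral_restrict_UNIV) auto
  also have "\<dots> = L2_inner \<Omega> w w + 2 * L2_inner \<Omega> (\<lambda>x. x $ i * w x) (partial_deriv i W)"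
    by (simp add: L2_inner_def L2_mult_integrable wL2 xwL2 GiL2)
  \<comment> \<open>The 2 of the final constant counts the two equal terms of the product rule;
    \<open>R\<close> will come from the bound on the coordinate over \<Omega>.\<close>
  finally have "L2_inner \<Omega> w w \<le> 2 * \<bar>L2_inner \<Omega> (\<lambda>x. x $ i * w x) (partial_deriv i W)\<bar>"
    by linarith
  also have "\<dots> \<le> 2 * (L2_norm \<Omega> (\<lambda>x. x $ i * w x) * L2_norm \<Omega> (partial_deriv i W))"
    using L2_Cauchy_Schwarz[OF xwL2 GiL2] by simp
  also have "\<dots> \<le> 2 * ((R * L2_norm \<Omega> w) * (1 * L2_norm \<Omega> (grad \<Omega> w)))"
    using \<Omega>(3) by (intro mult_left_mono mult_mono xw_le Gi_le mult_nonneg_nonneg L2_norm_nonneg) auto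
  finally have "L2_norm \<Omega> w * L2_norm \<Omega> w \<le> L2_norm \<Omega> w * (2 * R * L2_norm \<Omega> (grad \<Omega> w))"
    by (simp add: L2_norm_power2[symmetric] power2_eq_square algebra_simps)
  then show ?thesis
    using \<Omega>(3) L2_norm_nonneg[of \<Omega> w] L2_norm_nonneg[of \<Omega> "grad \<Omega> w"]
    by (cases "L2_norm \<Omega> w = 0") (auto simp: mult_le_cancel_left)
qed


section \<open>The two-grid estimate\<close>

theorem theorem3p3:
  fixes \<Omega> :: "(real^'d) set"
    and F :: "nat \<Rightarrow> real^'d \<Rightarrow> real"
    and \<sigma> :: real
  assumes "CARD('d) = 2 \<or> CARD('d) = 3"
    and "bounded \<Omega>" and "lipschitz_domain \<Omega>"
    and "\<forall>i\<in>{1,2,3}. F i \<in> L2 \<Omega>"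
    and "uniquely_solvable \<Omega> F (H10 \<Omega>)"
    and "\<sigma> > 0"
  shows "\<exists>C>0. \<forall>h H \<Gamma>h \<Gamma>H ph \<phi>h pH \<phi>H ps \<phi>s.
    quasi_uniform_triangulation \<Omega> \<sigma> h \<Gamma>h \<and> quasi_uniform_triangulation \<Omega> \<sigma> H \<Gamma>H \<and>
    uniquely_solvable \<Omega> F (fe_space \<Omega> \<Gamma>h) \<and> uniquely_solvable \<Omega> F (fe_space \<Omega> \<Gamma>H) \<and>
    PNP_solution \<Omega> F (fe_space \<Omega> \<Gamma>h) ph \<phi>h \<and>
    PNP_solution \<Omega> F (fe_space \<Omega> \<Gamma>H) pH \<phi>H \<and>
    two_grid_solution \<Omega> F (fe_space \<Omega> \<Gamma>h) pH \<phi>H ps \<phi>s \<longrightarrow>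
    L2_norm \<Omega> (grad \<Omega> (\<lambda>x. \<phi>h x - \<phi>s x))
      \<le> C * (\<Sum>i\<in>{1,2}. L2_norm \<Omega> (\<lambda>x. ph i x - pH i x))"
proof -
  have "open \<Omega>" using assms(3) by (simp add: lipschitz_domain_def)
  \<comment> \<open>\<open>R\<close> is fixed before any mesh is introduced, so the constant
    \<open>2 * R\<close> depends on \<Omega> alone.\<close>
  obtain R where R: "R > 0" "\<Omega> \<subseteq> cball 0 R"
    using assms(2) by (force simp: bounded_pos)
  have main: "L2_norm \<Omega> (grad \<Omega> (\<lambda>x. \<phi>h x - \<phi>s x))
      \<le> (2 * R) * (\<Sum>i\<in>{1,2}. L2_norm \<Omega> (\<lambda>x. ph i x - pH i x))"
    if tri: "quasi_uniform_triangulation \<Omega> \<sigma> h \<Gamma>h"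
      and fine: "PNP_solution \<Omega> F (fe_space \<Omega> \<Gamma>h) ph \<phi>h"
      and coarse: "PNP_solution \<Omega> F (fe_space \<Omega> \<Gamma>H) pH \<phi>H"
      and two_grid: "two_grid_solution \<Omega> F (fe_space \<Omega> \<Gamma>h) pH \<phi>H ps \<phi>s"
    for h \<Gamma>h \<Gamma>H ph \<phi>h pH \<phi>H ps \<phi>s
  proof -
    define w where "w = (\<lambda>x. \<phi>h x - \<phi>s x)"
    have fe: "\<phi>h \<in> fe_space \<Omega> \<Gamma>h" "\<phi>s \<in> fe_space \<Omega> \<Gamma>h"
      using fine two_grid by (auto simp: PNP_solution_def two_grid_solution_def)
    then have H1: "\<phi>h \<in> H1 \<Omega>" "\<phi>s \<in> H1 \<Omega>" by (auto simp: fe_space_def)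
    have w: "w \<in> fe_space \<Omega> \<Gamma>h"
      unfolding w_def by (rule fe_space_diff[OF \<open>open \<Omega>\<close> assms(2) fe])
    then have wH1: "w \<in> H1 \<Omega>" and wL2: "w \<in> L2 \<Omega>" by (auto simp: fe_space_def H1_def)
    have pL2: "ph i \<in> L2 \<Omega>" "pH i \<in> L2 \<Omega>" if "i \<in> {1,2}" for i
      using fine coarse that by (auto simp: PNP_solution_def fe_space_def H1_def)
    define S where "S = (\<Sum>i\<in>{1,2}. L2_norm \<Omega> (\<lambda>x. ph i x - pH i x))"
    have "S \<ge> 0" unfolding S_def by (intro sum_nonneg L2_norm_nonneg)
    have "L2_inner \<Omega> (grad \<Omega> w) (grad \<Omega> w) = L2_inner \<Omega> (\<lambda>x. grad \<Omega> \<phi>h x - grad \<Omega> \<phi>s x) (grad \<Omega> w)"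
      unfolding L2_inner_def
    proof (rule integral_cong_AE)
      show "AE x in lebesgue_on \<Omega>. grad \<Omega> w x \<bullet> grad \<Omega> w x = (grad \<Omega> \<phi>h x - grad \<Omega> \<phi>s x) \<bullet> grad \<Omega> w x"
        using H1_diff(2)[OF \<open>open \<Omega>\<close> assms(2) H1] by eventually_elim (simp add: w_def)
    qed (intro borel_measurable_integrable L2_inner_integrable L2_diff grad_H1 wH1 H1)+
    also have "\<dots> = L2_inner \<Omega> (grad \<Omega> \<phi>h) (grad \<Omega> w) - L2_inner \<Omega> (grad \<Omega> \<phi>s) (grad \<Omega> w)"
      by (intro L2_inner_diff_left grad_H1 H1 wH1)
    \<comment> \<open>Both Poisson equations may be tested with \<open>w\<close>, a member of the
      fine space; their common source term \<open>F 3\<close> cancels.\<close>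
    also have "\<dots> = (\<Sum>i\<in>{1,2}. valence i * L2_inner \<Omega> (ph i) w) - (\<Sum>i\<in>{1,2}. valence i * L2_inner \<Omega> (pH i) w)"
      using fine two_grid w by (simp add: PNP_solution_def two_grid_solution_def)
    also have "\<dots> = (\<Sum>i\<in>{1,2}. valence i * L2_inner \<Omega> (\<lambda>x. ph i x - pH i x) w)"
      unfolding sum_subtractf[symmetric]
      by (intro sum.cong refl) (simp add: L2_inner_diff_left pL2 wL2 algebra_simps)
    also have "\<dots> \<le> (\<Sum>i\<in>{1,2}. L2_norm \<Omega> (\<lambda>x. ph i x - pH i x) * L2_norm \<Omega> w)"
    proof (rule sum_mono)
      fix i :: nat assume i: "i \<in> {1,2}"
      \<comment> \<open>Valences are 1 or -1, so the absolute value absorbs them.\<close>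
      have "valence i * L2_inner \<Omega> (\<lambda>x. ph i x - pH i x) w \<le> \<bar>L2_inner \<Omega> (\<lambda>x. ph i x - pH i x) w\<bar>"
        by (simp add: valence_def abs_ge_self abs_ge_minus_self)
      also have "\<dots> \<le> L2_norm \<Omega> (\<lambda>x. ph i x - pH i x) * L2_norm \<Omega> w"
        by (rule L2_Cauchy_Schwarz[OF L2_diff wL2]) (use pL2 i in auto)
      finally show "valence i * L2_inner \<Omega> (\<lambda>x. ph i x - pH i x) w
          \<le> L2_norm \<Omega> (\<lambda>x. ph i x - pH i x) * L2_norm \<Omega> w" .
    qed
    also have "\<dots> = S * L2_norm \<Omega> w" by (simp only: S_def sum_distrib_right)
    also have "\<dots> \<le> S * (2 * R * L2_norm \<Omega> (grad \<Omega> w))"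
      by (intro mult_left_mono fe_space_Poincare[OF \<open>open \<Omega>\<close> R(2,1) tri w] \<open>S \<ge> 0\<close>)
    \<comment> \<open>One factor \<open>L2_norm \<Omega> (grad \<Omega> w)\<close> cancels; if it is
      0, the estimate is trivial because \<open>S\<close> is nonnegative.\<close>
    finally have "L2_norm \<Omega> (grad \<Omega> w) * L2_norm \<Omega> (grad \<Omega> w) \<le> L2_norm \<Omega> (grad \<Omega> w) * (2 * R * S)"
      by (simp add: L2_norm_power2[symmetric] power2_eq_square algebra_simps)
    then have "L2_norm \<Omega> (grad \<Omega> w) \<le> 2 * R * S"
      using L2_norm_nonneg[of \<Omega> "grad \<Omega> w"] R(1) \<open>S \<ge> 0\<close>
      by (cases "L2_norm \<Omega> (grad \<Omega> w) = 0") (auto simp: mult_le_cancel_left)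
    then show ?thesis by (simp only: S_def w_def)
  qed
  show ?thesis
    using R(1) by (intro exI[of _ "2 * R"]) (use main in auto)
qed

end
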